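(* Let $\mu$ be a doubling measure in $\mathbb{R}^n$ and consider a functional $Y:\mathcal{Q}\to(0,\infty)$. The following two conditions on a weight $w\in L^1_{\mathrm{loc}}(\mathbb{R}^n,d\mu)$ are equivalent: (1) There is some constant $B>0$ such that \[ \frac1{Y(Q)}\int_Q|f(x)-f_{Q,\mu}|\,dw(x)\le B\,\|f\|_{\mathrm{BMO}(d\mu)} \] for every function $f\in\mathrm{BMO}(d\mu)$ and every cube $Q$ in $\mathbb{R}^n$. (2) The weight $w$ is an $A_{\infty,Y}(d\mu)$ weight, i.e. \[ [w]_{A_{\infty,Y}(d\mu)}:=\sup_{Q\in\mathcal{Q}}\frac1{Y(Q)}\int_QM_\mu(w\chi_Q)(x)\,d\mu(x)<\infty . \] Moreover, there exist positive constants $C_1$ and $C_2$ such that $C_1B\le[w]_{A_{\infty,Y}(d\mu)}\le C_2B$.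
   Context: $\mathcal{Q}$ is the family of all cubes in $\mathbb{R}^n$. A measure $\mu$ on $\mathbb{R}^n$ is doubling if there are positive constants $c_\mu$, $n_\mu$ with $\mu(\tilde Q)\le c_\mu(\ell(\tilde Q)/\ell(Q))^{n_\mu}\mu(Q)$ for all cubes $Q\subset\tilde Q$, where $\ell$ is side length. A weight is a nonnegative locally integrable function, and $dw$ denotes the measure $w\,d\mu$. Put $f_{Q,\mu}=\frac1{\mu(Q)}\int_Q f\,d\mu$ and $\|f\|_{\mathrm{BMO}(d\mu)}=\sup_{Q\in\mathcal{Q}}\frac1{\mu(Q)}\int_Q|f-f_{Q,\mu}|\,d\mu$; $\mathrm{BMO}(d\mu)$ is the set of $f\in L^1_{\mathrm{loc}}(\mathbb{R}^n,d\mu)$ for which this is finite. $M_\mu$ is the Hardy–Littlewood maximal operator with respect to $\mu$, $M_\mu g(x)=\sup_{Q\in\mathcal{Q},\,Q\ni x}\frac1{\mu(Q)}\int_Q|g|\,d\mu$. In the last sentence of the claim, $B$ is the constant in (1). *)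

theory Defs
  imports "HOL-Analysis.Analysis"
begin

text \<open>Cubes are closed, nondegenerate, with sides parallel to the coordinate axes; \<^term>\<open>cube a l\<close>
  has lowest corner \<^term>\<open>a\<close> and side length \<^term>\<open>l\<close>.\<close>

definition cube :: "real ^ 'n \<Rightarrow> real \<Rightarrow> (real ^ 'n) set" where
  "cube a l = cbox a (\<chi> i. a $ i + l)"

definition cubes :: "(real ^ 'n) set set" where
  "cubes = {cube a l | a l. l > 0}"

text \<open>Besides the growth condition, a doubling measure is a Borel measure that gives every cube
  positive and finite mass, so that the averages over cubes make sense (this excludes
  the zero measure and the measure that is infinite on all cubes).\<close>

definition doubling_measure :: "(real ^ 'n) measure \<Rightarrow> bool" where
  "doubling_measure \<mu> \<longleftrightarrow>
     sets \<mu> = sets borel \<and>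
     (\<forall>Q\<in>cubes. 0 < emeasure \<mu> Q \<and> emeasure \<mu> Q < \<infinity>) \<and>
     (\<exists>c>0. \<exists>d>0. \<forall>a l a' l'. l > 0 \<longrightarrow> l' > 0 \<longrightarrow> cube a l \<subseteq> cube a' l' \<longrightarrow>
        emeasure \<mu> (cube a' l') \<le> ennreal (c * (l' / l) powr d) * emeasure \<mu> (cube a l))"

definition locally_integrable :: "(real ^ 'n) measure \<Rightarrow> (real ^ 'n \<Rightarrow> real) \<Rightarrow> bool" where
  "locally_integrable \<mu> f \<longleftrightarrow> (\<forall>K. compact K \<longrightarrow> set_integrable \<mu> K f)"

definition weight :: "(real ^ 'n) measure \<Rightarrow> (real ^ 'n \<Rightarrow> real) \<Rightarrow> bool" where
  "weight \<mu> w \<longleftrightarrow> (\<forall>x. 0 \<le> w x) \<and> locally_integrable \<mu> w"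

definition average :: "(real ^ 'n) measure \<Rightarrow> (real ^ 'n \<Rightarrow> real) \<Rightarrow> (real ^ 'n) set \<Rightarrow> real" where
  "average \<mu> f Q = (LINT x:Q|\<mu>. f x) / measure \<mu> Q"

definition bmo_norm :: "(real ^ 'n) measure \<Rightarrow> (real ^ 'n \<Rightarrow> real) \<Rightarrow> ennreal" where
  "bmo_norm \<mu> f =
     (SUP Q\<in>cubes. (\<integral>\<^sup>+x\<in>Q. ennreal \<bar>f x - average \<mu> f Q\<bar> \<partial>\<mu>) / emeasure \<mu> Q)"

definition BMO :: "(real ^ 'n) measure \<Rightarrow> (real ^ 'n \<Rightarrow> real) set" where
  "BMO \<mu> = {f. locally_integrable \<mu> f \<and> bmo_norm \<mu> f < \<infinity>}"

definition maximal :: "(real ^ 'n) measure \<Rightarrow> (real ^ 'n \<Rightarrow> real) \<Rightarrow> real ^ 'n \<Rightarrow> ennreal" where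
  "maximal \<mu> g x =
     (SUP Q\<in>{Q \<in> cubes. x \<in> Q}. (\<integral>\<^sup>+y\<in>Q. ennreal \<bar>g y\<bar> \<partial>\<mu>) / emeasure \<mu> Q)"

definition weighted_bmo_bound ::
  "(real ^ 'n) measure \<Rightarrow> ((real ^ 'n) set \<Rightarrow> real) \<Rightarrow> (real ^ 'n \<Rightarrow> real) \<Rightarrow> real \<Rightarrow> bool" where
  "weighted_bmo_bound \<mu> Y w B \<longleftrightarrow>
     (\<forall>f\<in>BMO \<mu>. \<forall>Q\<in>cubes.
        (\<integral>\<^sup>+x\<in>Q. ennreal \<bar>f x - average \<mu> f Q\<bar> \<partial>density \<mu> (\<lambda>x. ennreal (w x))) / ennreal (Y Q)
          \<le> ennreal B * bmo_norm \<mu> f)"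

text \<open>The optimal constant in the weighted bound; it is \<^term>\<open>\<infinity> :: ennreal\<close> if no constant works.\<close>

definition best_bmo_const ::
  "(real ^ 'n) measure \<Rightarrow> ((real ^ 'n) set \<Rightarrow> real) \<Rightarrow> (real ^ 'n \<Rightarrow> real) \<Rightarrow> ennreal" where
  "best_bmo_const \<mu> Y w = (INF B\<in>{B. 0 < B \<and> weighted_bmo_bound \<mu> Y w B}. ennreal B)"

definition A_infty_const ::
  "(real ^ 'n) measure \<Rightarrow> ((real ^ 'n) set \<Rightarrow> real) \<Rightarrow> (real ^ 'n \<Rightarrow> real) \<Rightarrow> ennreal" where
  "A_infty_const \<mu> Y w =
     (SUP Q\<in>cubes. (\<integral>\<^sup>+x\<in>Q. maximal \<mu> (\<lambda>y. w y * indicator Q y) x \<partial>\<mu>) / ennreal (Y Q))"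

end

theory Submission
  imports Defs
begin

text \<open>
  Both implications rest on one comparison: up to constants depending on \<open>\<mu>\<close> alone, the weight of
  the oscillation of a BMO function over a cube \<open>Q\<close> is controlled by the integral over \<open>Q\<close> of the maximal
  function of \<open>w\<close> restricted to \<open>Q\<close>, and suitable BMO functions attain this bound.

  From (2) to (1). Subdivide \<open>Q\<close> dyadically. Starting from \<open>Q\<close>, stop at the first cells on which the
  average of \<open>f\<close> has moved by more than a multiple of the BMO norm; by the definition of the norm these
  cells fill at most half of \<open>Q\<close>. Iterating yields a sparse family of cells \<open>P\<close> such that
  \<open>\<bar>f - f\<^sub>Q\<bar>\<close> is bounded by a multiple of the norm times the sum of the indicators of the cells. Its
  integral against \<open>w\<close> is then a multiple of the sum of the masses \<open>w(P)\<close>, each of which is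
  \<open>\<mu>(P)\<close> times an average of \<open>w\<close>, hence at most twice the integral of the maximal function over the part of
  \<open>P\<close> that is not covered by later cells; and these parts are disjoint. The induction in
  \<open>laminar_family_bound\<close> carries out this argument for a finite tree of cells, where \<open>f\<close> is replaced by
  its averages over the leaves. As the levels increase these averages tend to \<open>f\<close> in $L^1(\mu)$
  (\<open>dyadic_mean_tendsto_L1\<close>), and Fatou's lemma gives \<open>weighted_oscillation_bound\<close>.

  From (1) to (2). The maximal function is an increasing limit of maxima of averages over finitely many
  cubes \<open>R\<^sub>j\<close> (\<open>maximal_countable_cubes\<close>). Assigning every point of \<open>Q\<close> to a cube where the maximum is attained
  splits \<open>Q\<close> into disjoint sets \<open>E\<^sub>j\<close> contained in \<open>R\<^sub>j\<close>, and exchanging integrals turns the integral of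
  the maximum into the integral of \<open>w F\<close> with \<open>F = \<Sum>\<^sub>j \<mu>(E\<^sub>j) / \<mu>(R\<^sub>j) \<chi>(R\<^sub>j)\<close>. After the
  indicators are replaced by Lipschitz bumps, \<open>F\<close> has BMO norm bounded by a constant that depends only
  on the doubling constant and the dimension (\<open>balayage_oscillation\<close>). Testing (1) with \<open>F\<close> bounds the
  integral of \<open>w \<bar>F - F\<^sub>Q\<bar>\<close>; the remaining term \<open>F\<^sub>Q w(Q)\<close> is bounded by testing (1) with the
  indicator of a subcube (\<open>weight_cube_le\<close>).
\<close>

section \<open>Cubes and doubling measures\<close>

lemma mem_cube: "x \<in> cube a l \<longleftrightarrow> (\<forall>i. a $ i \<le> x $ i \<and> x $ i \<le> a $ i + l)"
  by (simp add: cube_def mem_box_cart)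

lemma compact_cube: "compact (cube a l)"
  by (simp add: cube_def)

lemma borel_cube [measurable]: "cube a l \<in> sets borel"
  by (simp add: cube_def)

lemma corner_mem_cube: "0 \<le> l \<Longrightarrow> a \<in> cube a l"
  by (simp add: mem_cube)

lemma cube_in_cubes: "0 < l \<Longrightarrow> cube a l \<in> cubes"
  by (auto simp: cubes_def)

lemma cubes_cases:
  assumes "Q \<in> cubes"
  obtains a l where "0 < l" "Q = cube a l"
  using assms by (auto simp: cubes_def)

lemma ball_cubes: "(\<forall>Q\<in>cubes. P Q) \<longleftrightarrow> (\<forall>a l. 0 < l \<longrightarrow> P (cube a l))"
  unfolding cubes_def by blast

lemma cube_subset_cube:
  assumes "\<And>i. b $ i \<le> a $ i" "\<And>i. a $ i + l \<le> b $ i + s"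
  shows "cube a l \<subseteq> cube b s"
proof
  fix x assume "x \<in> cube a l"
  then have "a $ i \<le> x $ i" "x $ i \<le> a $ i + l" for i by (simp_all add: mem_cube)
  then show "x \<in> cube b s" unfolding mem_cube using assms by (meson order_trans)
qed

lemma dist_cube_le:
  fixes x y :: "real ^ 'n" and l :: real
  assumes "x \<in> cube a l" "y \<in> cube a l"
  shows "dist x y \<le> CARD('n) * l"
proof -
  have "dist x y \<le> (\<Sum>i\<in>UNIV. \<bar>(x - y) $ i\<bar>)"
    unfolding dist_norm by (rule norm_le_l1_cart)
  also have "\<dots> \<le> (\<Sum>i\<in>(UNIV :: 'n set). l)"
  proof (rule sum_mono)
    fix i :: 'n
    have "a $ i \<le> x $ i" "x $ i \<le> a $ i + l" "a $ i \<le> y $ i" "y $ i \<le> a $ i + l"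
      using assms by (simp_all add: mem_cube)
    then show "\<bar>(x - y) $ i\<bar> \<le> l" by simp
  qed
  finally show ?thesis by simp
qed

text \<open>Only cubes whose side lengths differ by a factor of at most $16$ are ever compared, so that a
  single constant \<open>D\<close> records all that is used of the growth condition.\<close>

locale doubling_cubes =
  fixes \<mu> :: "(real ^ 'n) measure" and D :: real
  assumes sets_mu [measurable_cong]: "sets \<mu> = sets borel"
    and cube_pos: "0 < l \<Longrightarrow> 0 < emeasure \<mu> (cube a l)"
    and cube_finite: "0 < l \<Longrightarrow> emeasure \<mu> (cube a l) < \<infinity>"
    and D_ge_1: "1 \<le> D"
    and doubling: "\<lbrakk>0 < l; 0 < l'; l' \<le> 16 * l; cube a l \<subseteq> cube a' l'\<rbrakk>
        \<Longrightarrow> measure \<mu> (cube a' l') \<le> D * measure \<mu> (cube a l)"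

lemma doubling_measure_imp_doubling_cubes:
  assumes "doubling_measure \<mu>"
  obtains D where "doubling_cubes \<mu> D"
proof -
  obtain c d where c: "c > 0" and d: "d > 0" and
    growth: "\<forall>a l a' l'. l > 0 \<longrightarrow> l' > 0 \<longrightarrow> cube a l \<subseteq> cube a' l' \<longrightarrow>
      emeasure \<mu> (cube a' l') \<le> ennreal (c * (l' / l) powr d) * emeasure \<mu> (cube a l)"
    using assms unfolding doubling_measure_def by (elim conjE exE) (rule that)
  have sets: "sets \<mu> = sets borel"
    and Q: "\<forall>Q\<in>cubes. 0 < emeasure \<mu> Q \<and> emeasure \<mu> Q < \<infinity>"
    using assms unfolding doubling_measure_def by simp_all
  have fin: "emeasure \<mu> (cube a l) < \<infinity>" and pos: "0 < emeasure \<mu> (cube a l)" if "l > 0" for a l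
    using Q cube_in_cubes[OF that] by auto
  define D where "D = max 1 (c * 16 powr d)"
  have "measure \<mu> (cube a' l') \<le> D * measure \<mu> (cube a l)"
    if "0 < l" "0 < l'" "l' \<le> 16 * l" "cube a l \<subseteq> cube a' l'" for a l a' l'
  proof -
    have "(l' / l) powr d \<le> 16 powr d"
      using that d by (intro powr_mono2) (auto simp: field_simps)
    then have le: "c * (l' / l) powr d \<le> D"
      using c by (auto simp: D_def le_max_iff_disj)
    have "ennreal (measure \<mu> (cube a' l')) = emeasure \<mu> (cube a' l')"
      using fin[OF that(2)] by (simp add: emeasure_eq_ennreal_measure less_top)
    also have "\<dots> \<le> ennreal (c * (l' / l) powr d) * emeasure \<mu> (cube a l)"
      using growth that by blast
    also have "\<dots> \<le> ennreal D * emeasure \<mu> (cube a l)"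
      using le by (intro mult_right_mono ennreal_leI) auto
    also have "\<dots> = ennreal (D * measure \<mu> (cube a l))"
      using fin[OF that(1)] by (simp add: emeasure_eq_ennreal_measure less_top ennreal_mult' D_def)
    finally show ?thesis
      by (subst (asm) ennreal_le_iff) (auto simp: D_def)
  qed
  then have "doubling_cubes \<mu> D"
    using sets fin pos by unfold_locales (simp_all add: D_def)
  then show thesis by (rule that)
qed

context doubling_cubes
begin

lemma space_mu [simp]: "space \<mu> = UNIV"
  using sets_eq_imp_space_eq[OF sets_mu] by simp

lemma sets_cube [measurable]: "cube a l \<in> sets \<mu>"
  by (simp add: sets_mu)

lemma emeasure_cube: "0 < l \<Longrightarrow> emeasure \<mu> (cube a l) = ennreal (measure \<mu> (cube a l))"
  using cube_finite by (simp add: emeasure_eq_ennreal_measure less_top)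

lemma measure_cube_pos: "0 < l \<Longrightarrow> 0 < measure \<mu> (cube a l)"
  using cube_pos[of l a] by (simp add: emeasure_cube)

lemma fmeasurable_cube: "0 < l \<Longrightarrow> cube a l \<in> fmeasurable \<mu>"
  using cube_finite by (intro fmeasurableI) (auto simp: sets_mu)

lemma fmeasurable_subset_cube:
  "0 < l \<Longrightarrow> A \<in> sets borel \<Longrightarrow> A \<subseteq> cube a l \<Longrightarrow> A \<in> fmeasurable \<mu>"
  using fmeasurableI2[OF fmeasurable_cube] by (simp add: sets_mu)

lemma set_integrable_subset_cube:
  fixes f :: "real ^ 'n \<Rightarrow> real"
  assumes "locally_integrable \<mu> f" "A \<in> sets borel" "A \<subseteq> cube a l"
  shows "set_integrable \<mu> A f"
proof (rule set_integrable_subset)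
  show "set_integrable \<mu> (cube a l) f"
    using assms(1) compact_cube unfolding locally_integrable_def by blast
qed (use assms in \<open>simp_all add: sets_mu\<close>)

lemma locally_integrable_borel:
  fixes f :: "real ^ 'n \<Rightarrow> real"
  assumes "locally_integrable \<mu> f"
  shows "f \<in> borel_measurable \<mu>"
proof -
  define K :: "nat \<Rightarrow> (real ^ 'n) set" where "K j = cball 0 (real j)" for j
  have "(\<lambda>x. indicator (K j) x *\<^sub>R f x) \<in> borel_measurable \<mu>" for j
    using assms unfolding locally_integrable_def set_integrable_def K_def
    by (intro borel_measurable_integrable) simp
  moreover have "(\<lambda>j. indicator (K j) x *\<^sub>R f x) \<longlonglongrightarrow> f x" for x
  proof -
    obtain j0 :: nat where "norm x \<le> real j0" using real_arch_simple by blast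
    then have "\<forall>\<^sub>F j in sequentially. indicator (K j) x *\<^sub>R f x = f x"
      by (intro eventually_sequentiallyI[of j0]) (auto simp: K_def)
    then show ?thesis by (rule tendsto_eventually)
  qed
  ultimately show ?thesis
    using borel_measurable_LIMSEQ_metric[of "\<lambda>j x. indicator (K j) x *\<^sub>R f x" \<mu> f] by blast
qed

end

section \<open>Oscillation about the mean\<close>

lemma set_nn_integral_eq_lebesgue:
  fixes f :: "'a \<Rightarrow> real"
  assumes "set_integrable M A f" "\<And>x. x \<in> A \<Longrightarrow> 0 \<le> f x"
  shows "(\<integral>\<^sup>+x\<in>A. ennreal (f x) \<partial>M) = ennreal (LINT x:A|M. f x)"
proof -
  have "(\<integral>\<^sup>+x\<in>A. ennreal (f x) \<partial>M) = (\<integral>\<^sup>+x. ennreal (indicator A x *\<^sub>R f x) \<partial>M)"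
    by (intro nn_integral_cong) (auto simp: indicator_def)
  also have "\<dots> = ennreal (LINT x|M. indicator A x *\<^sub>R f x)"
    using assms unfolding set_integrable_def
    by (intro nn_integral_eq_integral) (auto simp: indicator_def)
  finally show ?thesis by (simp add: set_lebesgue_integral_def)
qed

lemma set_integrable_diff_const:
  fixes f :: "'a \<Rightarrow> real"
  assumes "set_integrable M A f" "A \<in> fmeasurable M"
  shows "set_integrable M A (\<lambda>x. f x - c)" "set_integrable M A (\<lambda>x. \<bar>f x - c\<bar>)"
proof -
  have "set_integrable M A (\<lambda>x. c)"
    using assms(2) unfolding set_integrable_def by (simp add: fmeasurable_def)
  then show "set_integrable M A (\<lambda>x. f x - c)" using assms(1) by (intro set_integral_diff)
  then show "set_integrable M A (\<lambda>x. \<bar>f x - c\<bar>)" by (rule set_integrable_abs)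
qed

lemma set_integral_constant:
  "A \<in> fmeasurable M \<Longrightarrow> (LINT x:A|M. c :: real) = c * measure M A"
  by (simp add: set_integral_const fmeasurable_def less_top)

text \<open>Averaging is a contraction of $L^1$. With \<open>c\<close> the average over a larger set, this compares averages
  over nested sets.\<close>

lemma measure_mult_average_diff_le:
  fixes f :: "real ^ 'n \<Rightarrow> real"
  assumes "A \<in> fmeasurable M" "0 < measure M A" "set_integrable M A f"
  shows "measure M A * \<bar>average M f A - c\<bar> \<le> (LINT x:A|M. \<bar>f x - c\<bar>)"
proof -
  note int = set_integrable_diff_const[OF assms(3,1)]
  have "set_integrable M A (\<lambda>x. c)"
    using assms(1) unfolding set_integrable_def by (simp add: fmeasurable_def)
  then have "(LINT x:A|M. f x - c) = (LINT x:A|M. f x) - c * measure M A"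
    using assms by (simp add: set_integral_constant set_integral_diff(2))
  also have "\<dots> = measure M A * (average M f A - c)"
    using assms(2) by (simp add: average_def field_simps)
  finally have "measure M A * \<bar>average M f A - c\<bar> = \<bar>LINT x:A|M. f x - c\<bar>"
    by (simp add: abs_mult)
  also have "\<dots> \<le> (LINT x:A|M. \<bar>f x - c\<bar>)"
    using set_integral_norm_bound[OF int(1)] by simp
  finally show ?thesis .
qed

text \<open>Hence the mean is, up to a factor $2$, the best constant approximation in $L^1$.\<close>

lemma mean_oscillation_le:
  fixes f :: "real ^ 'n \<Rightarrow> real"
  assumes "A \<in> fmeasurable M" "0 < measure M A" "set_integrable M A f"
  shows "(LINT x:A|M. \<bar>f x - average M f A\<bar>) \<le> 2 * (LINT x:A|M. \<bar>f x - c\<bar>)"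
proof -
  note int = set_integrable_diff_const[OF assms(3,1)]
  let ?m = "average M f A"
  have const: "set_integrable M A (\<lambda>x. \<bar>?m - c\<bar>)"
    using assms(1) unfolding set_integrable_def by (simp add: fmeasurable_def)
  have "(LINT x:A|M. \<bar>f x - ?m\<bar>) \<le> (LINT x:A|M. \<bar>f x - c\<bar> + \<bar>?m - c\<bar>)"
    by (intro set_integral_mono int set_integral_add const) auto
  also have "\<dots> = (LINT x:A|M. \<bar>f x - c\<bar>) + \<bar>?m - c\<bar> * measure M A"
    using assms(1) by (subst set_integral_add(2)) (auto intro: int const simp: set_integral_constant)
  also have "\<dots> \<le> 2 * (LINT x:A|M. \<bar>f x - c\<bar>)"
    using measure_mult_average_diff_le[OF assms, of c] by (simp add: mult.commute)
  finally show ?thesis .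
qed

section \<open>Stopping cells in a laminar family\<close>

lemma sum_indicator_disjnt:
  fixes f :: "'a set \<Rightarrow> ennreal"
  assumes "finite S" "pairwise disjnt S" "A \<in> S" "x \<in> A"
  shows "(\<Sum>B\<in>S. f B * indicator B x) = f A"
proof -
  have "(\<Sum>B\<in>S. f B * indicator B x) = (\<Sum>B\<in>S. if B = A then f A else 0)"
    using assms(2-4) by (intro sum.cong refl) (auto simp: pairwise_def disjnt_def indicator_def)
  also have "\<dots> = f A"
    using assms(1,3) by simp
  finally show ?thesis .
qed

text \<open>Think of \<open>F\<close> as a finite tree of cells, of \<open>h\<close> as the averages of a function over the cells and of
  \<open>g\<close> as its averages over the leaves. Below \<open>P\<close> stop at the first cells on which \<open>h\<close> differs from
  \<open>h P\<close> by more than \<open>2 * C\<close>. The oscillation bound \<open>osc\<close> makes the stopping cells fill at most half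
  of \<open>P\<close>; the bound \<open>jump\<close> keeps \<open>h\<close> within \<open>3 * C\<close> of \<open>h P\<close> on them. So \<open>\<bar>g - h P\<bar>\<close> is at most \<open>3 * C\<close>,
  plus \<open>\<bar>g - h R\<bar>\<close> on each stopping cell \<open>R\<close>, where the claim is known inductively. The first term
  costs \<open>3 * C\<close> times the \<open>w\<close>-mass of \<open>P\<close>, which is paid for by the integral of the majorant \<open>v\<close> over the
  half of \<open>P\<close> outside the stopping cells. The contributions of different generations therefore
  use disjoint parts of \<open>P\<close>, and the constant does not grow with the depth of the tree.\<close>

theorem laminar_family_bound:
  fixes M :: "'a measure" and F :: "'a set set" and h :: "'a set \<Rightarrow> real"
    and g :: "'a \<Rightarrow> real" and w v :: "'a \<Rightarrow> ennreal" and C :: real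
  assumes fin: "finite F"
    and meas: "\<And>P. P \<in> F \<Longrightarrow> P \<in> fmeasurable M" "\<And>P. P \<in> F \<Longrightarrow> 0 < measure M P"
    and laminar: "\<And>P R. P \<in> F \<Longrightarrow> R \<in> F \<Longrightarrow> P \<subseteq> R \<or> R \<subseteq> P \<or> P \<inter> R = {}"
    and jump: "\<And>P R. P \<in> F \<Longrightarrow> R \<in> F \<Longrightarrow> R \<subset> P \<Longrightarrow>
                 \<exists>R'\<in>F. R \<subset> R' \<and> R' \<subseteq> P \<and> \<bar>h R - h R'\<bar> \<le> C"
    and osc: "\<And>P S. P \<in> F \<Longrightarrow> S \<subseteq> F \<Longrightarrow> pairwise disjnt S \<Longrightarrow> \<Union>S \<subseteq> P \<Longrightarrow>
                 (\<Sum>R\<in>S. measure M R * \<bar>h R - h P\<bar>) \<le> C * measure M P"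
    and leaf: "\<And>P x. P \<in> F \<Longrightarrow> x \<in> P \<Longrightarrow> \<exists>R\<in>F. x \<in> R \<and> R \<subseteq> P \<and> g x = h R"
    and C: "0 < C"
    and borel [measurable]: "w \<in> borel_measurable M" "v \<in> borel_measurable M" "g \<in> borel_measurable M"
    and dom: "\<And>P x. P \<in> F \<Longrightarrow> x \<in> P \<Longrightarrow> (\<integral>\<^sup>+y\<in>P. w y \<partial>M) \<le> v x * emeasure M P"
    and P: "P \<in> F"
  shows "(\<integral>\<^sup>+x\<in>P. w x * ennreal \<bar>g x - h P\<bar> \<partial>M) \<le> ennreal (6 * C) * (\<integral>\<^sup>+x\<in>P. v x \<partial>M)"
  using P
proof (induction "card {R \<in> F. R \<subset> P}" arbitrary: P rule: less_induct)
  case less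
  note P = \<open>P \<in> F\<close>
  have sets [measurable]: "R \<in> sets M" if "R \<in> F" for R
    using meas(1)[OF that] by (simp add: fmeasurable_def)
  \<comment> \<open>the stopping sets: maximal members below \<open>P\<close> on which \<open>h\<close> has moved away from \<open>h P\<close>\<close>
  define Bad where "Bad = {R \<in> F. R \<subset> P \<and> \<bar>h R - h P\<bar> > 2 * C}"
  define S where "S = {R \<in> Bad. \<forall>R'\<in>Bad. \<not> R \<subset> R'}"
  define U where "U = \<Union>S"
  have finBad: "finite Bad" and finS: "finite S" and SF: "S \<subseteq> F"
    using fin by (auto simp: Bad_def S_def)
  have disj: "pairwise disjnt S"
  proof (rule pairwiseI)
    fix R R' assume "R \<in> S" "R' \<in> S" "R \<noteq> R'"
    then show "disjnt R R'"
      using laminar[of R R'] unfolding S_def Bad_def disjnt_def by blast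
  qed
  have UP: "U \<subseteq> P" by (auto simp: U_def S_def Bad_def)
  have U [measurable]: "U \<in> sets M"
    unfolding U_def using finS SF sets by (intro sets.finite_Union) auto
  have cover: "x \<in> U" if R: "R \<in> Bad" "x \<in> R" for R x
  proof -
    obtain m where "m \<in> Bad" "R \<subseteq> m" "\<forall>b\<in>Bad. m \<subseteq> b \<longrightarrow> m = b"
      using finite_has_maximal2[OF finBad R(1)] by blast
    then show ?thesis using R(2) unfolding U_def S_def by blast
  qed
  have near: "\<bar>h R - h P\<bar> \<le> 3 * C" if "R \<in> S" for R
  proof -
    have R: "R \<in> F" "R \<subset> P" using that by (auto simp: S_def Bad_def)
    obtain R' where R': "R' \<in> F" "R \<subset> R'" "R' \<subseteq> P" "\<bar>h R - h R'\<bar> \<le> C"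
      using jump[OF P R] by blast
    have "\<bar>h R' - h P\<bar> \<le> 2 * C"
    proof (cases "R' = P")
      case False
      then have "R' \<notin> Bad" using that R'(2) by (auto simp: S_def)
      then show ?thesis using False R' by (auto simp: Bad_def)
    qed (use C in simp)
    then show ?thesis using R'(4) by linarith
  qed
  \<comment> \<open>by the oscillation bound the stopping sets fill at most half of \<open>P\<close>\<close>
  have "2 * C * measure M U = (\<Sum>R\<in>S. measure M R * (2 * C))"
    unfolding U_def using measure_Union'[OF finS _ disj] SF meas
    by (subst measure_Union'[OF finS _ disj]) (auto simp: sum_distrib_left sum_distrib_right mult.commute)
  also have "\<dots> \<le> (\<Sum>R\<in>S. measure M R * \<bar>h R - h P\<bar>)"
    by (intro sum_mono mult_left_mono) (auto simp: S_def Bad_def)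
  also have "\<dots> \<le> C * measure M P"
    using osc[OF P SF disj] UP by (simp add: U_def)
  finally have half: "2 * measure M U \<le> measure M P"
    using C by simp
  have "measure M (P - U) = measure M P - measure M U"
    using measurable_measure_Diff[OF meas(1)[OF P] U UP] .
  with half have "measure M P \<le> 2 * measure M (P - U)" by simp
  moreover have "P - U \<in> fmeasurable M" using meas(1)[OF P] U by (rule fmeasurable_Diff)
  ultimately have half': "emeasure M P \<le> 2 * emeasure M (P - U)"
    using meas(1)[OF P] by (simp add: emeasure_eq_measure2 ennreal_mult[symmetric] ennreal_leI flip: ennreal_numeral)
  let ?W = "\<integral>\<^sup>+y\<in>P. w y \<partial>M"
  have "emeasure M P * ?W \<le> 2 * emeasure M (P - U) * ?W"
    using half' by (rule mult_right_mono) simp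
  also have "\<dots> = 2 * (\<integral>\<^sup>+x\<in>P - U. ?W \<partial>M)"
    using sets[OF P] by (subst nn_integral_cmult_indicator) (auto simp: mult_ac)
  also have "\<dots> \<le> 2 * (\<integral>\<^sup>+x\<in>P - U. v x * emeasure M P \<partial>M)"
    using dom[OF P] by (intro mult_left_mono nn_integral_mono) (auto simp: indicator_def)
  also have "(\<integral>\<^sup>+x\<in>P - U. v x * emeasure M P \<partial>M) = emeasure M P * (\<integral>\<^sup>+x\<in>P - U. v x \<partial>M)"
    using sets[OF P] by (subst nn_integral_cmult[symmetric]) (auto simp: mult_ac)
  finally have "emeasure M P * ?W \<le> emeasure M P * (2 * (\<integral>\<^sup>+x\<in>P - U. v x \<partial>M))"
    by (simp add: mult_ac)
  then have W: "?W \<le> 2 * (\<integral>\<^sup>+x\<in>P - U. v x \<partial>M)"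
    using meas(2)[OF P] meas(1)[OF P]
    by (subst (asm) ennreal_mult_le_mult_iff) (auto simp: emeasure_eq_measure2)
  have pointwise: "w x * ennreal \<bar>g x - h P\<bar> * indicator P x \<le> ennreal (3 * C) * (w x * indicator P x) +
      (\<Sum>R\<in>S. (w x * ennreal \<bar>g x - h R\<bar>) * indicator R x)" for x
  proof (cases "x \<in> P")
    case xP: True
    show ?thesis
    proof (cases "x \<in> U")
      case True
      then obtain A where A: "A \<in> S" "x \<in> A" by (auto simp: U_def)
      have "\<bar>g x - h P\<bar> \<le> 3 * C + \<bar>g x - h A\<bar>"
        using near[OF A(1)] by linarith
      then have "ennreal \<bar>g x - h P\<bar> \<le> ennreal (3 * C) + ennreal \<bar>g x - h A\<bar>"
        using C by (subst ennreal_plus[symmetric]) (auto intro!: ennreal_leI simp del: ennreal_plus)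
      then have "w x * ennreal \<bar>g x - h P\<bar> \<le> w x * (ennreal (3 * C) + ennreal \<bar>g x - h A\<bar>)"
        by (rule mult_left_mono) simp
      then show ?thesis
        using xP unfolding sum_indicator_disjnt[OF finS disj A] by (simp add: distrib_left mult_ac)
    next
      case False
      obtain R where R: "R \<in> F" "x \<in> R" "R \<subseteq> P" "g x = h R"
        using leaf[OF P xP] by blast
      have "R \<notin> Bad" using cover[of R x] R False by blast
      then have "\<bar>g x - h P\<bar> \<le> 3 * C"
        using R C by (cases "R = P") (auto simp: Bad_def)
      then have "w x * ennreal \<bar>g x - h P\<bar> \<le> w x * ennreal (3 * C)"
        by (intro mult_left_mono ennreal_leI) auto
      then show ?thesis
        using xP by (simp add: mult_ac add_increasing2)
    qed
  qed simp
  have IH: "(\<integral>\<^sup>+x\<in>R. w x * ennreal \<bar>g x - h R\<bar> \<partial>M) \<le> ennreal (6 * C) * (\<integral>\<^sup>+x\<in>R. v x \<partial>M)" if "R \<in> S" for R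
  proof (rule less.hyps)
    have R: "R \<in> F" "R \<subset> P" using that by (auto simp: S_def Bad_def)
    then show "R \<in> F" by simp
    have "{R' \<in> F. R' \<subset> R} \<subset> {R' \<in> F. R' \<subset> P}" using R by blast
    then show "card {R' \<in> F. R' \<subset> R} < card {R' \<in> F. R' \<subset> P}"
      using fin by (intro psubset_card_mono) auto
  qed
  have sumv: "v x * indicator (P - U) x + (\<Sum>R\<in>S. v x * indicator R x) \<le> v x * indicator P x" for x
  proof (cases "x \<in> U")
    case True
    then obtain A where A: "A \<in> S" "x \<in> A" by (auto simp: U_def)
    then show ?thesis
      using True UP sum_indicator_disjnt[OF finS disj A, of "\<lambda>_. v x"] by auto
  next
    case False
    then have "(\<Sum>R\<in>S. v x * indicator R x) = 0" by (auto simp: U_def)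
    then show ?thesis by (auto simp: indicator_def)
  qed
  have "(\<integral>\<^sup>+x\<in>P. w x * ennreal \<bar>g x - h P\<bar> \<partial>M) \<le>
      (\<integral>\<^sup>+x. ennreal (3 * C) * (w x * indicator P x) +
         (\<Sum>R\<in>S. (w x * ennreal \<bar>g x - h R\<bar>) * indicator R x) \<partial>M)"
    by (intro nn_integral_mono pointwise)
  also have "\<dots> = ennreal (3 * C) * ?W + (\<Sum>R\<in>S. \<integral>\<^sup>+x\<in>R. w x * ennreal \<bar>g x - h R\<bar> \<partial>M)"
    using sets[OF P] SF sets
    by (subst nn_integral_add) (auto intro!: borel_measurable_sum simp: nn_integral_cmult nn_integral_sum subset_iff)
  also have "\<dots> \<le> ennreal (3 * C) * (2 * (\<integral>\<^sup>+x\<in>P - U. v x \<partial>M)) + (\<Sum>R\<in>S. ennreal (6 * C) * (\<integral>\<^sup>+x\<in>R. v x \<partial>M))"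
    by (intro add_mono mult_left_mono W sum_mono IH) auto
  also have "ennreal (3 * C) * (2 * (\<integral>\<^sup>+x\<in>P - U. v x \<partial>M)) = ennreal (6 * C) * (\<integral>\<^sup>+x\<in>P - U. v x \<partial>M)"
  proof -
    have "ennreal (3 * C) * 2 = ennreal (6 * C)"
      using C by (simp add: ennreal_mult''[symmetric] flip: ennreal_numeral)
    then show ?thesis by (simp add: mult.assoc[symmetric])
  qed
  also have "ennreal (6 * C) * (\<integral>\<^sup>+x\<in>P - U. v x \<partial>M) + (\<Sum>R\<in>S. ennreal (6 * C) * (\<integral>\<^sup>+x\<in>R. v x \<partial>M)) =
      ennreal (6 * C) * (\<integral>\<^sup>+x. v x * indicator (P - U) x + (\<Sum>R\<in>S. v x * indicator R x) \<partial>M)"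
    using sets[OF P] SF sets
    by (subst nn_integral_add)
      (auto intro!: borel_measurable_sum simp: nn_integral_sum subset_iff distrib_left sum_distrib_left)
  also have "\<dots> \<le> ennreal (6 * C) * (\<integral>\<^sup>+x\<in>P. v x \<partial>M)"
    by (intro mult_left_mono nn_integral_mono sumv) auto
  finally show ?case .
qed

section \<open>Dyadic cells of a cube\<close>

text \<open>The last of the \<open>2 ^ k\<close> intervals of level \<open>k\<close> is closed on the right, so that the cells partition
  the closed cube and nothing has to be known about the measure of its boundary.\<close>

definition dyadic_index :: "nat \<Rightarrow> real \<Rightarrow> int" where
  "dyadic_index k t = min \<lfloor>2 ^ k * t\<rfloor> (2 ^ k - 1)"

definition dyadic_cell :: "real ^ 'n \<Rightarrow> real \<Rightarrow> nat \<Rightarrow> real ^ 'n \<Rightarrow> (real ^ 'n) set" where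
  "dyadic_cell a l k x =
     {y \<in> cube a l. \<forall>i. dyadic_index k ((y $ i - a $ i) / l) = dyadic_index k ((x $ i - a $ i) / l)}"

definition dyadic_cells :: "real ^ 'n \<Rightarrow> real \<Rightarrow> nat \<Rightarrow> (real ^ 'n) set set" where
  "dyadic_cells a l k = dyadic_cell a l k ` cube a l"

lemma dyadic_index_Suc: "dyadic_index (Suc k) t div 2 = dyadic_index k t"
proof -
  have mono: "min x y div 2 = min (x div 2) (y div 2)" for x y :: int
    by (auto simp: min_def zdiv_mono1)
  have "\<lfloor>2 ^ Suc k * t / real_of_int 2\<rfloor> = \<lfloor>2 ^ Suc k * t\<rfloor> div 2"
    by (rule floor_divide_real_eq_div) simp
  then have "\<lfloor>2 ^ Suc k * t\<rfloor> div 2 = \<lfloor>2 ^ k * t\<rfloor>" by simp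
  then show ?thesis by (simp add: dyadic_index_def mono)
qed

lemma dyadic_index_bounds:
  assumes "0 \<le> t" "t \<le> 1"
  shows "0 \<le> dyadic_index k t" "dyadic_index k t \<le> 2 ^ k - 1"
    and "real_of_int (dyadic_index k t) \<le> 2 ^ k * t" "2 ^ k * t \<le> real_of_int (dyadic_index k t) + 1"
proof -
  have t: "0 \<le> 2 ^ k * t" "2 ^ k * t \<le> 2 ^ k" using assms by auto
  have one: "(1::int) \<le> 2 ^ k" by simp
  show "0 \<le> dyadic_index k t" "dyadic_index k t \<le> 2 ^ k - 1"
    using t(1) one unfolding dyadic_index_def by auto
  show "real_of_int (dyadic_index k t) \<le> 2 ^ k * t"
    by (simp only: le_floor_iff[symmetric] dyadic_index_def min.cobounded1)
  show "2 ^ k * t \<le> real_of_int (dyadic_index k t) + 1"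
    using t(2) unfolding dyadic_index_def by (auto simp: min_def)
qed

lemma dyadic_index_eqI:
  assumes "m \<le> 2 ^ k - 1" "real_of_int m \<le> 2 ^ k * t" "2 ^ k * t < real_of_int m + 1"
  shows "dyadic_index k t = m"
proof -
  have "\<lfloor>2 ^ k * t\<rfloor> = m" using assms(2,3) by (simp add: floor_unique)
  then show ?thesis using assms(1) by (simp add: dyadic_index_def)
qed

lemma dyadic_cell_subset: "dyadic_cell a l k x \<subseteq> cube a l"
  by (auto simp: dyadic_cell_def)

lemma mem_dyadic_cell: "x \<in> cube a l \<Longrightarrow> x \<in> dyadic_cell a l k x"
  by (simp add: dyadic_cell_def)

lemma dyadic_cell_eq: "y \<in> dyadic_cell a l k x \<Longrightarrow> dyadic_cell a l k y = dyadic_cell a l k x"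
  by (simp add: dyadic_cell_def)

lemma dyadic_cell_antimono: "j \<le> k \<Longrightarrow> dyadic_cell a l k x \<subseteq> dyadic_cell a l j x"
proof (induction rule: dec_induct)
  case (step k)
  have "dyadic_cell a l (Suc k) x \<subseteq> dyadic_cell a l k x"
    unfolding dyadic_cell_def dyadic_index_Suc[of k, symmetric] by auto
  with step show ?case by blast
qed simp

lemma dyadic_cell_0:
  assumes "0 < l" "x \<in> cube a l"
  shows "dyadic_cell a l 0 x = cube a l"
proof -
  have "dyadic_index 0 ((y $ i - a $ i) / l) = 0" if "y \<in> cube a l" for y i
    using that assms(1) by (simp add: dyadic_index_def mem_cube)
  then show ?thesis using assms(2) by (auto simp: dyadic_cell_def)
qed

lemma borel_dyadic_cell [measurable]: "dyadic_cell a l k x \<in> sets borel"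
proof -
  have "dyadic_cell a l k x = cube a l \<inter>
      (\<Inter>i. {y \<in> space borel. dyadic_index k ((y $ i - a $ i) / l) = dyadic_index k ((x $ i - a $ i) / l)})"
    by (auto simp: dyadic_cell_def)
  moreover have "{y \<in> space borel. dyadic_index k ((y $ i - a $ i) / l) = c} \<in> sets borel" for i c
    unfolding dyadic_index_def by measurable
  ultimately show ?thesis by (auto intro!: sets.Int sets.finite_INT)
qed

lemma finite_dyadic_cells:
  assumes "0 < l"
  shows "finite (dyadic_cells a l k :: (real ^ 'n) set set)"
proof -
  let ?I = "{0..2 ^ k - 1 :: int}"
  define c where "c \<phi> = {y \<in> cube a l. \<forall>i. dyadic_index k ((y $ i - a $ i) / l) = \<phi> i}" for \<phi> :: "'n \<Rightarrow> int"
  have "dyadic_cells a l k \<subseteq> c ` (UNIV \<rightarrow>\<^sub>E ?I)"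
  proof
    fix R assume "R \<in> dyadic_cells a l k"
    then obtain x where x: "x \<in> cube a l" "R = dyadic_cell a l k x" by (auto simp: dyadic_cells_def)
    define \<phi> where "\<phi> i = dyadic_index k ((x $ i - a $ i) / l)" for i
    have "0 \<le> (x $ i - a $ i) / l" "(x $ i - a $ i) / l \<le> 1" for i
      using x(1) assms by (auto simp: mem_cube field_simps)
    then have "\<phi> \<in> UNIV \<rightarrow>\<^sub>E ?I" using dyadic_index_bounds(1,2) by (auto simp: \<phi>_def)
    moreover have "R = c \<phi>" by (simp add: x c_def dyadic_cell_def \<phi>_def)
    ultimately show "R \<in> c ` (UNIV \<rightarrow>\<^sub>E ?I)" by blast
  qed
  moreover have "finite (UNIV \<rightarrow>\<^sub>E ?I :: ('n \<Rightarrow> int) set)"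
    by (intro finite_PiE) auto
  ultimately show ?thesis by (meson finite_surj)
qed

lemma dyadic_cell_between_cubes:
  assumes l: "0 < l" and x: "x \<in> cube a l"
  obtains b where "cube b (l / 2 ^ k / 2) \<subseteq> dyadic_cell a l k x"
    and "dyadic_cell a l k x \<subseteq> cube b (l / 2 ^ k)" and "cube b (l / 2 ^ k) \<subseteq> cube a l"
proof
  define T where "T y i = (y $ i - a $ i) / l" for y i
  define m where "m i = dyadic_index k (T x i)" for i
  define b where "b = (\<chi> i. a $ i + l * m i / 2 ^ k)"
  have T: "0 \<le> T y i" "T y i \<le> 1" if "y \<in> cube a l" for y i
    using that l by (auto simp: T_def mem_cube field_simps)
  note m = dyadic_index_bounds[where k = k, OF T[OF x], folded m_def]
  have m1: "real_of_int (m i) + 1 \<le> 2 ^ k" for i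
  proof -
    have "m i + 1 \<le> 2 ^ k" using m(2)[of i] by simp
    then have "real_of_int (m i + 1) \<le> real_of_int (2 ^ k)" by (rule of_int_le_iff[THEN iffD2])
    then show ?thesis by simp
  qed
  have T_cube: "b $ i \<le> y $ i \<and> y $ i \<le> b $ i + l / 2 ^ k * r \<longleftrightarrow> m i \<le> 2 ^ k * T y i \<and> 2 ^ k * T y i \<le> m i + r"
    for y i and r :: real
    using l by (simp add: b_def T_def field_simps)
  show sub: "cube b (l / 2 ^ k) \<subseteq> cube a l"
  proof
    fix y assume y: "y \<in> cube b (l / 2 ^ k)"
    show "y \<in> cube a l"
      unfolding mem_cube
    proof
      fix i
      have "m i \<le> 2 ^ k * T y i" "2 ^ k * T y i \<le> m i + 1"
        using y T_cube[of i y 1] by (auto simp: mem_cube)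
      with m1[of i] m(1)[of i] have "2 ^ k * 0 \<le> 2 ^ k * T y i" "2 ^ k * T y i \<le> 2 ^ k * 1" by linarith+
      moreover have "(0 :: real) < 2 ^ k" by simp
      ultimately have "0 \<le> T y i" "T y i \<le> 1" by (simp_all only: mult_le_cancel_left_pos)
      then show "a $ i \<le> y $ i \<and> y $ i \<le> a $ i + l"
        using l by (simp add: T_def field_simps)
    qed
  qed
  show "dyadic_cell a l k x \<subseteq> cube b (l / 2 ^ k)"
  proof
    fix y assume y: "y \<in> dyadic_cell a l k x"
    then have "y \<in> cube a l" and "dyadic_index k (T y i) = m i" for i
      by (auto simp: dyadic_cell_def m_def T_def)
    then have "m i \<le> 2 ^ k * T y i" "2 ^ k * T y i \<le> m i + 1" for i
      using dyadic_index_bounds(3,4)[OF T[of y i], of k] by simp_all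
    then show "y \<in> cube b (l / 2 ^ k)"
      using T_cube[of _ y 1] by (simp add: mem_cube)
  qed
  show "cube b (l / 2 ^ k / 2) \<subseteq> dyadic_cell a l k x"
  proof
    fix y assume y: "y \<in> cube b (l / 2 ^ k / 2)"
    have "y \<in> cube b (l / 2 ^ k)"
      using cube_subset_cube[of b b "l / 2 ^ k / 2" "l / 2 ^ k"] y l by (auto simp: divide_le_eq field_simps)
    with sub have "y \<in> cube a l" by blast
    moreover have "dyadic_index k (T y i) = m i" for i
    proof (rule dyadic_index_eqI)
      show "m i \<le> 2 ^ k - 1" by (rule m)
      show "real_of_int (m i) \<le> 2 ^ k * T y i" "2 ^ k * T y i < real_of_int (m i) + 1"
        using y T_cube[of i y "1/2"] by (auto simp: mem_cube)
    qed
    ultimately show "y \<in> dyadic_cell a l k x"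
      by (simp add: dyadic_cell_def T_def m_def)
  qed
qed

lemma Union_dyadic_cells: "\<Union>(dyadic_cells a l k) = cube a l"
  unfolding dyadic_cells_def
proof
  show "\<Union>(dyadic_cell a l k ` cube a l) \<subseteq> cube a l"
    using dyadic_cell_subset by (rule UN_least)
  show "cube a l \<subseteq> \<Union>(dyadic_cell a l k ` cube a l)"
    using mem_dyadic_cell by (intro subsetI UN_I)
qed

lemma mem_dyadic_cellsD: "x \<in> R \<Longrightarrow> R \<in> dyadic_cells a l k \<Longrightarrow> R = dyadic_cell a l k x"
  unfolding dyadic_cells_def using dyadic_cell_eq[of x a l k, symmetric] by (elim imageE) simp

lemma dyadic_cells_nested:
  assumes "R \<in> dyadic_cells a l k" "P \<in> dyadic_cells a l j" "j \<le> k"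
  shows "R \<subseteq> P \<or> R \<inter> P = {}"
proof (cases "R \<inter> P = {}")
  case False
  then obtain z where "z \<in> R" "z \<in> P" by blast
  then have "R = dyadic_cell a l k z" "P = dyadic_cell a l j z"
    using mem_dyadic_cellsD[OF _ assms(1)] mem_dyadic_cellsD[OF _ assms(2)] by blast+
  then show ?thesis using dyadic_cell_antimono[OF assms(3)] by blast
qed simp

lemma pairwise_disjnt_dyadic_cells: "pairwise disjnt (dyadic_cells a l k)"
proof (rule pairwiseI)
  fix R P assume "R \<in> dyadic_cells a l k" "P \<in> dyadic_cells a l k" "R \<noteq> P"
  then show "disjnt R P"
    using mem_dyadic_cellsD[of _ R a l k] mem_dyadic_cellsD[of _ P a l k] by (auto simp: disjnt_iff)
qed

context doubling_cubes
begin

lemma dyadic_cells_fmeasurable: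
  assumes "0 < l" "R \<in> dyadic_cells a l k"
  shows "R \<in> fmeasurable \<mu>" "0 < measure \<mu> R"
proof -
  obtain x where x: "x \<in> cube a l" and R: "R = dyadic_cell a l k x"
    using assms(2) by (auto simp: dyadic_cells_def)
  show fm: "R \<in> fmeasurable \<mu>"
    unfolding R using assms(1) borel_dyadic_cell dyadic_cell_subset by (rule fmeasurable_subset_cube)
  obtain b where b: "cube b (l / 2 ^ k / 2) \<subseteq> R"
    using dyadic_cell_between_cubes[OF assms(1) x, of k] R by metis
  have "0 < measure \<mu> (cube b (l / 2 ^ k / 2))" using assms(1) by (intro measure_cube_pos) auto
  also have "\<dots> \<le> measure \<mu> R" using b fm by (intro measure_mono_fmeasurable) auto
  finally show "0 < measure \<mu> R" .
qed

text \<open>A cell is comparable to a cube that contains it; this replaces averages over cells, which are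
  not cubes, by averages over cubes.\<close>

lemma dyadic_cell_in_comparable_cube:
  assumes l: "0 < l" and R: "R \<in> dyadic_cells a l k"
  obtains b s where "0 < s" "R \<subseteq> cube b s" "cube b s \<subseteq> cube a l"
    "measure \<mu> (cube b s) \<le> D * measure \<mu> R"
proof -
  obtain x where x: "x \<in> cube a l" and Rx: "R = dyadic_cell a l k x"
    using R by (auto simp: dyadic_cells_def)
  obtain b where b: "cube b (l / 2 ^ k / 2) \<subseteq> R" "R \<subseteq> cube b (l / 2 ^ k)" "cube b (l / 2 ^ k) \<subseteq> cube a l"
    using dyadic_cell_between_cubes[OF l x, of k] Rx by metis
  have "measure \<mu> (cube b (l / 2 ^ k)) \<le> D * measure \<mu> (cube b (l / 2 ^ k / 2))"
    using l b by (intro doubling) (auto simp: field_simps)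
  also have "\<dots> \<le> D * measure \<mu> R"
    using b(1) D_ge_1 dyadic_cells_fmeasurable(1)[OF l R] by (intro mult_left_mono measure_mono_fmeasurable) auto
  finally show thesis using b l by (intro that[of "l / 2 ^ k" b]) auto
qed

text \<open>This bounds the change of the averages of a BMO function from one level to the next.\<close>

lemma measure_dyadic_parent_le:
  assumes l: "0 < l" and x: "x \<in> cube a l"
  shows "measure \<mu> (dyadic_cell a l k x) \<le> D * measure \<mu> (dyadic_cell a l (Suc k) x)"
proof -
  have cells: "dyadic_cell a l j x \<in> fmeasurable \<mu>" for j
    using x by (intro dyadic_cells_fmeasurable[OF l]) (auto simp: dyadic_cells_def)
  obtain b where b: "dyadic_cell a l k x \<subseteq> cube b (l / 2 ^ k)"
    using dyadic_cell_between_cubes[OF l x, of k] by metis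
  obtain b' where b': "cube b' (l / 2 ^ Suc k / 2) \<subseteq> dyadic_cell a l (Suc k) x"
    using dyadic_cell_between_cubes[OF l x, of "Suc k"] by metis
  have "cube b' (l / 2 ^ Suc k / 2) \<subseteq> cube b (l / 2 ^ k)"
    using b b' dyadic_cell_antimono[of k "Suc k" a l x] by auto
  then have "measure \<mu> (cube b (l / 2 ^ k)) \<le> D * measure \<mu> (cube b' (l / 2 ^ Suc k / 2))"
    using l by (intro doubling) (auto simp: field_simps)
  also have "\<dots> \<le> D * measure \<mu> (dyadic_cell a l (Suc k) x)"
    using b' D_ge_1 cells by (intro mult_left_mono measure_mono_fmeasurable) auto
  finally show ?thesis
    using measure_mono_fmeasurable[OF b _ fmeasurable_cube] l cells by (fastforce simp: fmeasurable_def)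
qed

text \<open>The conditional expectation of \<open>f\<close> given the cells of level \<open>k\<close>, extended by zero outside the
  cube.\<close>

definition dyadic_mean :: "real ^ 'n \<Rightarrow> real \<Rightarrow> (real ^ 'n \<Rightarrow> real) \<Rightarrow> nat \<Rightarrow> real ^ 'n \<Rightarrow> real" where
  "dyadic_mean a l f k x = (\<Sum>R\<in>dyadic_cells a l k. average \<mu> f R * indicator R x)"

lemma dyadic_mean_eq:
  assumes "0 < l" "R \<in> dyadic_cells a l k" "x \<in> R"
  shows "dyadic_mean a l f k x = average \<mu> f R"
proof -
  have "dyadic_mean a l f k x = (\<Sum>R'\<in>dyadic_cells a l k. if R' = R then average \<mu> f R else 0)"
    unfolding dyadic_mean_def using assms(2,3) pairwise_disjnt_dyadic_cells[of a l k]
    by (intro sum.cong refl) (auto simp: pairwise_def disjnt_def indicator_def)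
  then show ?thesis using assms(2) finite_dyadic_cells[OF assms(1), of a k] by simp
qed

lemma borel_dyadic_mean [measurable]:
  assumes "0 < l"
  shows "dyadic_mean a l f k \<in> borel_measurable \<mu>"
  unfolding dyadic_mean_def
  using dyadic_cells_fmeasurable(1)[OF assms]
  by (intro borel_measurable_sum borel_measurable_times borel_measurable_indicator) auto

end

section \<open>Convergence of dyadic means\<close>

definition dyadic_step :: "real ^ 'n \<Rightarrow> real \<Rightarrow> nat \<Rightarrow> (real ^ 'n \<Rightarrow> real) \<Rightarrow> bool" where
  "dyadic_step a l k s \<longleftrightarrow> (\<forall>x\<in>cube a l. \<forall>y\<in>dyadic_cell a l k x. s y = s x)"

lemma dyadic_step_mono: "dyadic_step a l j s \<Longrightarrow> j \<le> k \<Longrightarrow> dyadic_step a l k s"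
  using dyadic_cell_antimono[of j k a l] unfolding dyadic_step_def by blast

context doubling_cubes
begin

lemma set_integrable_dyadic_cell:
  fixes f :: "real ^ 'n \<Rightarrow> real"
  assumes "0 < l" "set_integrable \<mu> (cube a l) f" "R \<in> dyadic_cells a l k"
  shows "set_integrable \<mu> R f"
proof (rule set_integrable_subset[OF assms(2)])
  show "R \<in> sets \<mu>" using dyadic_cells_fmeasurable[OF assms(1,3)] by (simp add: fmeasurable_def)
  show "R \<subseteq> cube a l" using assms(3) Union_dyadic_cells by blast
qed

lemma integrable_dyadic_mean:
  assumes "0 < l"
  shows "integrable \<mu> (dyadic_mean a l f k)"
  unfolding dyadic_mean_def
  using dyadic_cells_fmeasurable(1)[OF assms]
  by (intro Bochner_Integration.integrable_sum integrable_mult_right integrable_real_indicator)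
    (auto simp: fmeasurable_def)

lemma dyadic_mean_L1_le:
  assumes l: "0 < l" and f: "set_integrable \<mu> (cube a l) f"
  shows "(LINT x|\<mu>. \<bar>dyadic_mean a l f k x\<bar>) \<le> (LINT x:cube a l|\<mu>. \<bar>f x\<bar>)"
proof -
  let ?\<R> = "dyadic_cells a l k"
  note fm = dyadic_cells_fmeasurable[OF l]
  have ind: "integrable \<mu> (\<lambda>x. \<bar>average \<mu> f R\<bar> * indicator R x)" if "R \<in> ?\<R>" for R
    using fm(1)[OF that] by (intro integrable_mult_right integrable_real_indicator) (auto simp: fmeasurable_def)
  have "(LINT x|\<mu>. \<bar>dyadic_mean a l f k x\<bar>) \<le> (LINT x|\<mu>. (\<Sum>R\<in>?\<R>. \<bar>average \<mu> f R\<bar> * indicator R x))"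
  proof (rule integral_mono)
    show "integrable \<mu> (\<lambda>x. \<bar>dyadic_mean a l f k x\<bar>)"
      using integrable_dyadic_mean[OF l] by (rule integrable_abs)
    show "integrable \<mu> (\<lambda>x. \<Sum>R\<in>?\<R>. \<bar>average \<mu> f R\<bar> * indicator R x)"
      using ind by (rule Bochner_Integration.integrable_sum)
    show "\<bar>dyadic_mean a l f k x\<bar> \<le> (\<Sum>R\<in>?\<R>. \<bar>average \<mu> f R\<bar> * indicator R x)" for x
      unfolding dyadic_mean_def
      by (rule order_trans[OF sum_abs]) (simp add: abs_mult)
  qed
  also have "\<dots> = (\<Sum>R\<in>?\<R>. measure \<mu> R * \<bar>average \<mu> f R - 0\<bar>)"
    using ind fm by (subst Bochner_Integration.integral_sum) (auto simp: mult.commute fmeasurable_def)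
  also have "\<dots> \<le> (\<Sum>R\<in>?\<R>. LINT x:R|\<mu>. \<bar>f x - 0\<bar>)"
    using fm set_integrable_dyadic_cell[OF l f]
    by (intro sum_mono measure_mult_average_diff_le) auto
  also have "\<dots> = (LINT x:(\<Union>R\<in>?\<R>. R)|\<mu>. \<bar>f x\<bar>)"
    using finite_dyadic_cells[OF l, of a k] pairwise_disjnt_dyadic_cells[of a l k] fm
      set_integrable_abs[OF set_integrable_dyadic_cell[OF l f]]
    by (subst set_integral_finite_Union)
      (auto simp: disjoint_family_on_def pairwise_def disjnt_def fmeasurable_def)
  finally show ?thesis by (simp add: Union_dyadic_cells)
qed

lemma dyadic_mean_diff:
  assumes "0 < l" "set_integrable \<mu> (cube a l) f" "set_integrable \<mu> (cube a l) s"
  shows "dyadic_mean a l (\<lambda>x. f x - s x) k x = dyadic_mean a l f k x - dyadic_mean a l s k x"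
proof -
  have "average \<mu> (\<lambda>x. f x - s x) R = average \<mu> f R - average \<mu> s R" if "R \<in> dyadic_cells a l k" for R
    using assms(2,3)[THEN set_integrable_dyadic_cell[OF assms(1) _ that]]
    by (simp add: average_def set_integral_diff diff_divide_distrib)
  then show ?thesis
    by (simp add: dyadic_mean_def sum_subtractf[symmetric] left_diff_distrib)
qed

lemma dyadic_mean_step:
  assumes l: "0 < l" and s: "dyadic_step a l k s" and x: "x \<in> cube a l"
  shows "dyadic_mean a l s k x = s x"
proof -
  let ?R = "dyadic_cell a l k x"
  have R: "?R \<in> dyadic_cells a l k" using x by (auto simp: dyadic_cells_def)
  note fm = dyadic_cells_fmeasurable[OF l R]
  have "(LINT y:?R|\<mu>. s y) = (LINT y:?R|\<mu>. s x)"
    using fm s x unfolding dyadic_step_def by (intro set_lebesgue_integral_cong) (auto simp: fmeasurable_def)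
  also have "\<dots> = s x * measure \<mu> ?R" using fm(1) by (rule set_integral_constant)
  finally have "average \<mu> s ?R = s x" using fm(2) by (simp add: average_def)
  then show ?thesis using dyadic_mean_eq[OF l R mem_dyadic_cell[OF x]] by simp
qed

text \<open>By outer regularity a Borel subset of the cube is, up to small measure, the trace of an open
  set, and an open set is the increasing union over \<open>k\<close> of the cells of level \<open>k\<close> that it contains.\<close>

lemma dyadic_approx_set:
  assumes l: "0 < l" and A: "A \<in> sets borel" and e: "0 < e"
  obtains k T where "T \<in> sets borel" "T \<subseteq> cube a l" "dyadic_step a l k (indicator T)"
    "measure \<mu> ((cube a l \<inter> A - T) \<union> (T - A)) \<le> e"
proof -
  let ?X = "cube a l"
  note fmX = fmeasurable_cube[OF l, of a]
  define \<nu> where "\<nu> = density \<mu> (indicator ?X)"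
  have \<nu>: "emeasure \<nu> B = ennreal (measure \<mu> (?X \<inter> B))" if "B \<in> sets borel" for B
  proof -
    have "emeasure \<nu> B = (\<integral>\<^sup>+x. indicator ?X x * indicator B x \<partial>\<mu>)"
      unfolding \<nu>_def using that by (intro emeasure_density) (auto simp: sets_mu)
    also have "\<dots> = (\<integral>\<^sup>+x. indicator (?X \<inter> B) x \<partial>\<mu>)"
      by (simp only: indicator_inter_arith)
    also have "\<dots> = emeasure \<mu> (?X \<inter> B)"
      using that by (intro nn_integral_indicator) (simp add: sets_mu)
    also have "?X \<inter> B \<in> fmeasurable \<mu>"
      using that fmX by (intro fmeasurable_Int_fmeasurable) (auto simp: sets_mu)
    then have "emeasure \<mu> (?X \<inter> B) = ennreal (measure \<mu> (?X \<inter> B))"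
      by (rule emeasure_eq_measure2)
    finally show ?thesis .
  qed
  have sets_\<nu>: "sets \<nu> = sets borel" by (simp add: \<nu>_def sets_mu)
  then have space_\<nu>: "space \<nu> = UNIV" by (metis sets_eq_imp_space_eq space_borel)
  have "emeasure \<nu> A < emeasure \<nu> A + ennreal (e / 2)"
    using e \<nu>[OF A] by (simp add: ennreal_less_iff flip: ennreal_plus)
  moreover have "emeasure \<nu> A = (INF U \<in> {U. A \<subseteq> U \<and> open U}. emeasure \<nu> U)"
    using sets_\<nu> _ A by (rule outer_regular) (simp add: space_\<nu> \<nu>)
  ultimately obtain U where U: "A \<subseteq> U" "open U" "emeasure \<nu> U < emeasure \<nu> A + ennreal (e / 2)"
    by (auto simp: INF_less_iff)
  have U_borel [measurable]: "U \<in> sets borel" using U(2) by simp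
  have fmU: "?X \<inter> B \<in> fmeasurable \<mu>" if "B \<in> sets borel" for B
    using that fmX by (intro fmeasurable_Int_fmeasurable) (auto simp: sets_mu)
  have "measure \<mu> (?X \<inter> U) < measure \<mu> (?X \<inter> A) + e / 2"
    using U(3) e by (simp add: \<nu> A ennreal_less_iff flip: ennreal_plus)
  then have near_A: "measure \<mu> (?X \<inter> U - ?X \<inter> A) \<le> e / 2"
    using U(1) fmU[OF A] fmU[OF U_borel]
    by (subst measurable_measure_Diff) (auto simp: fmeasurable_def)
  define T where "T k = \<Union>{R \<in> dyadic_cells a l k. R \<subseteq> U}" for k
  have TI: "x \<in> T k" if "x \<in> ?X" "dyadic_cell a l k x \<subseteq> U" for x k
    using that mem_dyadic_cell[of x a l k] unfolding T_def dyadic_cells_def by blast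
  have TD: "x \<in> ?X \<and> dyadic_cell a l k x \<subseteq> U" if "x \<in> T k" for x k
    using that mem_dyadic_cellsD[of x _ a l k] Union_dyadic_cells[of a l k] unfolding T_def by blast
  have T_borel: "T k \<in> sets borel" for k
    unfolding T_def using finite_dyadic_cells[OF l, of a k] 
    by (intro sets.finite_Union) (auto simp: dyadic_cells_def)
  have TU: "T k \<subseteq> ?X \<inter> U" for k
    using TD mem_dyadic_cell by blast
  have range_T: "range T \<subseteq> sets \<mu>" using T_borel by (auto simp: sets_mu)
  have "incseq T"
  proof (rule incseq_SucI, rule subsetI)
    fix k x assume "x \<in> T k"
    then show "x \<in> T (Suc k)"
      using TD[of x k] dyadic_cell_antimono[of k "Suc k" a l x] by (intro TI) auto
  qed
  moreover have T_Un: "(\<Union>k. T k) = ?X \<inter> U"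
  proof (intro equalityI subsetI)
    fix x assume x: "x \<in> ?X \<inter> U"
    then obtain r where r: "0 < r" "ball x r \<subseteq> U" using U(2) open_contains_ball by blast
    have "(\<lambda>k. CARD('n) * (l / 2 ^ k)) \<longlonglongrightarrow> real CARD('n) * 0"
      by (intro tendsto_mult tendsto_const LIMSEQ_divide_realpow_zero) simp
    then have "\<forall>\<^sub>F k in sequentially. CARD('n) * (l / 2 ^ k) < r"
      using r(1) by (intro order_tendstoD(2)) auto
    then obtain k where k: "CARD('n) * (l / 2 ^ k) < r"
      using eventually_happens' sequentially_bot by blast
    obtain b where b: "dyadic_cell a l k x \<subseteq> cube b (l / 2 ^ k)"
      using dyadic_cell_between_cubes[OF l IntD1[OF x], of k] by metis
    have "dyadic_cell a l k x \<subseteq> ball x r"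
    proof
      fix y assume "y \<in> dyadic_cell a l k x"
      then have "dist x y \<le> CARD('n) * (l / 2 ^ k)"
        using b mem_dyadic_cell[of x a l k] x by (intro dist_cube_le) auto
      then show "y \<in> ball x r" using k by simp
    qed
    then show "x \<in> (\<Union>k. T k)" using TI[of x k] x r(2) by blast
  qed (use TU in blast)
  ultimately have "(\<lambda>k. measure \<mu> (T k)) \<longlonglongrightarrow> measure \<mu> (?X \<inter> U)"
    using Lim_measure_incseq[of T \<mu>] range_T fmU[OF U_borel] by (simp add: fmeasurable_def)
  then have "\<forall>\<^sub>F k in sequentially. measure \<mu> (?X \<inter> U) - e / 2 < measure \<mu> (T k)"
    using e by (intro order_tendstoD(1)) auto
  then obtain k where k: "measure \<mu> (?X \<inter> U) - e / 2 < measure \<mu> (T k)"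
    using eventually_happens' sequentially_bot by blast
  have near_T: "measure \<mu> (?X \<inter> U - T k) \<le> e / 2"
    using k TU fmU[OF U_borel] T_borel
    by (subst measurable_measure_Diff) (auto simp: fmeasurable_def sets_mu)
  have diffs: "?X \<inter> U - T k \<in> fmeasurable \<mu>" "?X \<inter> U - ?X \<inter> A \<in> fmeasurable \<mu>"
    using fmU[OF U_borel] fmU[OF A] T_borel by (auto intro!: fmeasurable_Diff simp: sets_mu fmeasurableD)
  have "measure \<mu> ((?X \<inter> A - T k) \<union> (T k - A)) \<le> measure \<mu> ((?X \<inter> U - T k) \<union> (?X \<inter> U - ?X \<inter> A))"
    using TU[of k] U(1) diffs A T_borel[of k]
    by (intro measure_mono_fmeasurable fmeasurable.Un) (auto simp: sets_mu)
  also have "\<dots> \<le> measure \<mu> (?X \<inter> U - T k) + measure \<mu> (?X \<inter> U - ?X \<inter> A)"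
    using diffs by (intro measure_Un_le) (auto simp: fmeasurableD)
  also have "\<dots> \<le> e" using near_A near_T by simp
  finally have "measure \<mu> ((?X \<inter> A - T k) \<union> (T k - A)) \<le> e" .
  moreover have "dyadic_step a l k (indicator (T k))"
    unfolding dyadic_step_def
  proof (intro ballI)
    fix x y assume "x \<in> ?X" "y \<in> dyadic_cell a l k x"
    then have "y \<in> T k \<longleftrightarrow> x \<in> T k"
      using TI TD dyadic_cell_eq[of y a l k x] dyadic_cell_subset[of a l k x] by (metis subsetD)
    then show "indicator (T k) y = (indicator (T k) x :: real)" by (simp add: indicator_def)
  qed
  ultimately show thesis using T_borel[of k] TU[of k] by (intro that[of "T k" k]) auto
qed

text \<open>Here \<open>u\<close> is integrable on the whole space rather than on the cube, which is the form that induction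
  over integrable functions requires.\<close>

lemma dyadic_step_dense_L1:
  assumes l: "0 < l" and u: "integrable \<mu> u" and e: "0 < e"
  shows "\<exists>k s. integrable \<mu> s \<and> dyadic_step a l k s \<and> (LINT x:cube a l|\<mu>. \<bar>u x - s x\<bar>) \<le> e"
  using u e
proof (induction u arbitrary: e rule: integrable_induct)
  case (base A c)
  let ?X = "cube a l"
  have A: "A \<in> sets borel" using base(1) by (simp add: sets_mu)
  have pos: "0 < e / (\<bar>c\<bar> + 1)" using base(3) by simp
  obtain k T where T: "T \<in> sets borel" "T \<subseteq> ?X" "dyadic_step a l k (indicator T)"
    and small: "measure \<mu> ((?X \<inter> A - T) \<union> (T - A)) \<le> e / (\<bar>c\<bar> + 1)" (is "measure \<mu> ?S \<le> _")
    by (rule dyadic_approx_set[OF l A pos, of a])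
  have fm: "T \<in> fmeasurable \<mu>" "?S \<in> fmeasurable \<mu>"
    using T(1,2) A by (auto intro!: fmeasurable_subset_cube[OF l, of _ a])
  have "integrable \<mu> (\<lambda>x. indicator T x *\<^sub>R c)"
    using fm by (intro integrable_scaleR_left integrable_real_indicator) (auto simp: fmeasurable_def)
  moreover have "dyadic_step a l k (\<lambda>x. indicator T x *\<^sub>R c)"
    using T(3) by (simp add: dyadic_step_def)
  moreover have "(LINT x:?X|\<mu>. \<bar>indicator A x *\<^sub>R c - indicator T x *\<^sub>R c\<bar>) \<le> e"
  proof -
    have "(LINT x:?X|\<mu>. \<bar>indicator A x *\<^sub>R c - indicator T x *\<^sub>R c\<bar>) = (LINT x|\<mu>. \<bar>c\<bar> * indicator ?S x)"
      unfolding set_lebesgue_integral_def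
      using T(2) by (intro Bochner_Integration.integral_cong) (auto simp: indicator_def)
    also have "\<dots> = \<bar>c\<bar> * measure \<mu> ?S" by simp
    also have "\<dots> \<le> (\<bar>c\<bar> + 1) * (e / (\<bar>c\<bar> + 1))"
      using small by (intro mult_mono) auto
    also have "\<dots> = e" by (simp add: add_nonneg_eq_0_iff)
    finally show ?thesis .
  qed
  ultimately show ?case by blast
next
  case (add f g)
  obtain j s where s: "integrable \<mu> s" "dyadic_step a l j s" "(LINT x:cube a l|\<mu>. \<bar>f x - s x\<bar>) \<le> e / 2"
    using add.IH(1)[of "e / 2"] add.prems by auto
  obtain k t where t: "integrable \<mu> t" "dyadic_step a l k t" "(LINT x:cube a l|\<mu>. \<bar>g x - t x\<bar>) \<le> e / 2"
    using add.IH(2)[of "e / 2"] add.prems by auto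
  have restrict: "set_integrable \<mu> (cube a l) h" if "integrable \<mu> h" for h :: "real ^ 'n \<Rightarrow> real"
    using that unfolding set_integrable_def by (intro integrable_mult_indicator) auto
  have "dyadic_step a l (max j k) (\<lambda>x. s x + t x)"
    using dyadic_step_mono[OF s(2), of "max j k"] dyadic_step_mono[OF t(2), of "max j k"]
    by (simp add: dyadic_step_def)
  moreover have "(LINT x:cube a l|\<mu>. \<bar>f x + g x - (s x + t x)\<bar>) \<le>
      (LINT x:cube a l|\<mu>. \<bar>f x - s x\<bar> + \<bar>g x - t x\<bar>)"
    using add.hyps s t by (intro set_integral_mono restrict) auto
  moreover have "\<dots> = (LINT x:cube a l|\<mu>. \<bar>f x - s x\<bar>) + (LINT x:cube a l|\<mu>. \<bar>g x - t x\<bar>)"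
    using add.hyps s t by (intro set_integral_add restrict) auto
  ultimately show ?case
    using s(1,3) t(1,3) by (intro exI[of _ "max j k"] exI[of _ "\<lambda>x. s x + t x"]) auto
next
  case (lim f u)
  have restrict: "set_integrable \<mu> (cube a l) h" if "integrable \<mu> h" for h :: "real ^ 'n \<Rightarrow> real"
    using that unfolding set_integrable_def by (intro integrable_mult_indicator) auto
  have "(\<lambda>i. LINT x|\<mu>. \<bar>f x - u i x\<bar>) \<longlonglongrightarrow> (LINT x|\<mu>. 0)"
  proof (rule integral_dominated_convergence[where w = "\<lambda>x. 3 * \<bar>f x\<bar>"])
    show "AE x in \<mu>. (\<lambda>i. \<bar>f x - u i x\<bar>) \<longlonglongrightarrow> 0"
    proof (rule AE_I2)
      fix x assume "x \<in> space \<mu>"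
      then have "(\<lambda>i. \<bar>f x - u i x\<bar>) \<longlonglongrightarrow> \<bar>f x - f x\<bar>"
        by (intro tendsto_intros lim.hyps)
      then show "(\<lambda>i. \<bar>f x - u i x\<bar>) \<longlonglongrightarrow> 0" by simp
    qed
    show "AE x in \<mu>. norm \<bar>f x - u i x\<bar> \<le> 3 * \<bar>f x\<bar>" for i
    proof (rule AE_I2)
      fix x assume "x \<in> space \<mu>"
      from lim.hyps(3)[OF this, of i] show "norm \<bar>f x - u i x\<bar> \<le> 3 * \<bar>f x\<bar>" by simp
    qed
  qed (use lim.hyps in \<open>auto intro!: borel_measurable_integrable\<close>)
  then have "\<forall>\<^sub>F i in sequentially. (LINT x|\<mu>. \<bar>f x - u i x\<bar>) < e / 2"
    using lim.prems by (intro order_tendstoD(2)) auto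
  then obtain i where i: "(LINT x|\<mu>. \<bar>f x - u i x\<bar>) < e / 2"
    using eventually_happens' sequentially_bot by blast
  have fu: "(LINT x:cube a l|\<mu>. \<bar>f x - u i x\<bar>) \<le> (LINT x|\<mu>. \<bar>f x - u i x\<bar>)"
    unfolding set_lebesgue_integral_def using lim.hyps
    by (intro integral_mono integrable_mult_indicator) (auto simp: indicator_def)
  obtain k s where s: "integrable \<mu> s" "dyadic_step a l k s" "(LINT x:cube a l|\<mu>. \<bar>u i x - s x\<bar>) \<le> e / 2"
    using lim.IH[of "e / 2" i] lim.prems by auto
  have "(LINT x:cube a l|\<mu>. \<bar>f x - s x\<bar>) \<le> (LINT x:cube a l|\<mu>. \<bar>f x - u i x\<bar> + \<bar>u i x - s x\<bar>)"
    using lim.hyps s by (intro set_integral_mono restrict) auto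
  also have "\<dots> = (LINT x:cube a l|\<mu>. \<bar>f x - u i x\<bar>) + (LINT x:cube a l|\<mu>. \<bar>u i x - s x\<bar>)"
    using lim.hyps s by (intro set_integral_add restrict) auto
  finally show ?case using s i fu by (intro exI[of _ k] exI[of _ s]) auto
qed

text \<open>Averaging over the cells of level \<open>k\<close> is an $L^1$ contraction that fixes the step functions of
  level at most \<open>k\<close>, and these are dense.\<close>

theorem dyadic_mean_tendsto_L1:
  assumes l: "0 < l" and f: "set_integrable \<mu> (cube a l) f"
  shows "(\<lambda>k. LINT x:cube a l|\<mu>. \<bar>dyadic_mean a l f k x - f x\<bar>) \<longlonglongrightarrow> 0"
proof (rule LIMSEQ_I)
  fix e :: real assume e: "0 < e"
  let ?X = "cube a l"
  have restrict: "set_integrable \<mu> ?X h" if "integrable \<mu> h" for h :: "real ^ 'n \<Rightarrow> real"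
    using that unfolding set_integrable_def by (intro integrable_mult_indicator) auto
  have "integrable \<mu> (\<lambda>x. indicator ?X x *\<^sub>R f x)" using f by (simp add: set_integrable_def)
  from dyadic_step_dense_L1[OF l this, of "e / 3" a] e obtain j s where
    s: "integrable \<mu> s" "dyadic_step a l j s" "(LINT x:?X|\<mu>. \<bar>indicator ?X x *\<^sub>R f x - s x\<bar>) \<le> e / 3"
    by auto
  have "(LINT x:?X|\<mu>. \<bar>indicator ?X x *\<^sub>R f x - s x\<bar>) = (LINT x:?X|\<mu>. \<bar>f x - s x\<bar>)"
    by (intro set_lebesgue_integral_cong) auto
  with s(3) have fs: "(LINT x:?X|\<mu>. \<bar>f x - s x\<bar>) \<le> e / 3" by simp
  have ints: "set_integrable \<mu> ?X s" "set_integrable \<mu> ?X (\<lambda>x. f x - s x)"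
    using restrict[OF s(1)] f by auto
  have "(LINT x:?X|\<mu>. \<bar>dyadic_mean a l f k x - f x\<bar>) < e" if "j \<le> k" for k
  proof -
    let ?E = "dyadic_mean a l (\<lambda>x. f x - s x) k"
    have E: "integrable \<mu> (\<lambda>x. \<bar>?E x\<bar>)" using integrable_dyadic_mean[OF l] by (rule integrable_abs)
    have "(LINT x:?X|\<mu>. \<bar>dyadic_mean a l f k x - f x\<bar>) \<le> (LINT x:?X|\<mu>. \<bar>?E x\<bar> + \<bar>f x - s x\<bar>)"
    proof (rule set_integral_mono)
      show "set_integrable \<mu> ?X (\<lambda>x. \<bar>dyadic_mean a l f k x - f x\<bar>)"
        using restrict[OF integrable_dyadic_mean[OF l]] f by (intro set_integrable_abs set_integral_diff)
      show "set_integrable \<mu> ?X (\<lambda>x. \<bar>?E x\<bar> + \<bar>f x - s x\<bar>)"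
        using restrict[OF E] set_integrable_abs[OF ints(2)] by (rule set_integral_add(1))
      show "\<bar>dyadic_mean a l f k x - f x\<bar> \<le> \<bar>?E x\<bar> + \<bar>f x - s x\<bar>" if "x \<in> ?X" for x
        using dyadic_mean_diff[OF l f ints(1), of k x]
          dyadic_mean_step[OF l dyadic_step_mono[OF s(2) \<open>j \<le> k\<close>] that] by simp
    qed
    also have "\<dots> = (LINT x:?X|\<mu>. \<bar>?E x\<bar>) + (LINT x:?X|\<mu>. \<bar>f x - s x\<bar>)"
      using restrict[OF E] set_integrable_abs[OF ints(2)] by (rule set_integral_add(2))
    also have "(LINT x:?X|\<mu>. \<bar>?E x\<bar>) \<le> (LINT x|\<mu>. \<bar>?E x\<bar>)"
      unfolding set_lebesgue_integral_def using E
      by (intro integral_mono integrable_mult_indicator) (auto simp: indicator_def)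
    also have "\<dots> \<le> (LINT x:?X|\<mu>. \<bar>f x - s x\<bar>)"
      by (rule dyadic_mean_L1_le[OF l ints(2)])
    finally show ?thesis using fs e by simp
  qed
  moreover have "0 \<le> (LINT x:?X|\<mu>. \<bar>dyadic_mean a l f k x - f x\<bar>)" for k
    unfolding set_lebesgue_integral_def by (intro integral_nonneg_AE) auto
  ultimately show "\<exists>j. \<forall>k\<ge>j. norm ((LINT x:?X|\<mu>. \<bar>dyadic_mean a l f k x - f x\<bar>) - 0) < e"
    by auto
qed

corollary dyadic_mean_AE_subseq:
  assumes l: "0 < l" and f: "set_integrable \<mu> (cube a l) f"
  obtains r :: "nat \<Rightarrow> nat" where "strict_mono r"
    "AE x in \<mu>. x \<in> cube a l \<longrightarrow> (\<lambda>k. dyadic_mean a l f (r k) x) \<longlonglongrightarrow> f x"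
proof -
  let ?X = "cube a l"
  let ?u = "\<lambda>k x. indicator ?X x *\<^sub>R (dyadic_mean a l f k x - f x)"
  have restrict: "set_integrable \<mu> ?X h" if "integrable \<mu> h" for h :: "real ^ 'n \<Rightarrow> real"
    using that unfolding set_integrable_def by (intro integrable_mult_indicator) auto
  have "integrable \<mu> (?u k)" for k
    using set_integral_diff(1)[OF restrict[OF integrable_dyadic_mean[OF l]] f]
    by (simp add: set_integrable_def)
  moreover have "(LINT x|\<mu>. norm (?u k x)) = (LINT x:?X|\<mu>. \<bar>dyadic_mean a l f k x - f x\<bar>)" for k
    unfolding set_lebesgue_integral_def by (intro Bochner_Integration.integral_cong) (auto simp: abs_mult)
  then have "(\<lambda>k. LINT x|\<mu>. norm (?u k x)) \<longlonglongrightarrow> 0"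
    using dyadic_mean_tendsto_L1[OF l f] by simp
  ultimately obtain r :: "nat \<Rightarrow> nat" where r: "strict_mono r" "AE x in \<mu>. (\<lambda>k. ?u (r k) x) \<longlonglongrightarrow> 0"
    using tendsto_L1_AE_subseq[of \<mu> ?u] by blast
  from r(2) have "AE x in \<mu>. x \<in> ?X \<longrightarrow> (\<lambda>k. dyadic_mean a l f (r k) x) \<longlonglongrightarrow> f x"
    by eventually_elim (auto intro: LIM_zero_cancel)
  with r(1) show thesis by (rule that)
qed

end

section \<open>Weighted oscillation of BMO functions\<close>

context doubling_cubes
begin

lemma bmo_norm_le_iff:
  assumes f: "locally_integrable \<mu> f" and \<beta>: "0 \<le> \<beta>"
  shows "bmo_norm \<mu> f \<le> ennreal \<beta> \<longleftrightarrow>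
    (\<forall>b s. 0 < s \<longrightarrow> (LINT x:cube b s|\<mu>. \<bar>f x - average \<mu> f (cube b s)\<bar>) \<le> \<beta> * measure \<mu> (cube b s))"
proof -
  have cube: "(\<integral>\<^sup>+x\<in>cube b s. ennreal \<bar>f x - average \<mu> f (cube b s)\<bar> \<partial>\<mu>) / emeasure \<mu> (cube b s) \<le> ennreal \<beta> \<longleftrightarrow>
      (LINT x:cube b s|\<mu>. \<bar>f x - average \<mu> f (cube b s)\<bar>) \<le> \<beta> * measure \<mu> (cube b s)" if s: "0 < s" for b s
  proof -
    have int: "set_integrable \<mu> (cube b s) (\<lambda>x. \<bar>f x - average \<mu> f (cube b s)\<bar>)"
      using f s by (intro set_integrable_diff_const fmeasurable_cube set_integrable_subset_cube[of f _ b s]) auto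
    have "0 \<le> (LINT x:cube b s|\<mu>. \<bar>f x - average \<mu> f (cube b s)\<bar>)"
      unfolding set_lebesgue_integral_def by (intro integral_nonneg_AE) auto
    then show ?thesis
      using \<beta> measure_cube_pos[OF s, of b]
      by (simp add: set_nn_integral_eq_lebesgue[OF int] emeasure_cube[OF s] divide_ennreal pos_divide_le_eq)
  qed
  show ?thesis
    by (simp add: bmo_norm_def SUP_le_iff ball_cubes cube)
qed

text \<open>The oscillation over a cell is compared with that about the mean over a comparable cube, to which
  the BMO bound applies.\<close>

lemma dyadic_cell_oscillation:
  assumes l: "0 < l" and f: "locally_integrable \<mu> f"
    and osc: "\<And>b s. 0 < s \<Longrightarrow>
      (LINT x:cube b s|\<mu>. \<bar>f x - average \<mu> f (cube b s)\<bar>) \<le> \<beta> * measure \<mu> (cube b s)"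
    and \<beta>: "0 \<le> \<beta>" and R: "R \<in> dyadic_cells a l k"
  shows "(LINT x:R|\<mu>. \<bar>f x - average \<mu> f R\<bar>) \<le> 2 * D * \<beta> * measure \<mu> R"
proof -
  obtain b s where b: "0 < s" "R \<subseteq> cube b s" "measure \<mu> (cube b s) \<le> D * measure \<mu> R"
    by (rule dyadic_cell_in_comparable_cube[OF l R])
  note fm = dyadic_cells_fmeasurable[OF l R]
  have int: "set_integrable \<mu> (cube b s) f"
    using f by (intro set_integrable_subset_cube[of f _ b s]) auto
  have intR: "set_integrable \<mu> R f"
    using fm b(2) by (intro set_integrable_subset[OF int]) (auto simp: fmeasurable_def)
  let ?m = "average \<mu> f (cube b s)"
  have "(LINT x:R|\<mu>. \<bar>f x - average \<mu> f R\<bar>) \<le> 2 * (LINT x:R|\<mu>. \<bar>f x - ?m\<bar>)"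
    using fm intR by (rule mean_oscillation_le)
  also have "(LINT x:R|\<mu>. \<bar>f x - ?m\<bar>) \<le> (LINT x:cube b s|\<mu>. \<bar>f x - ?m\<bar>)"
    using set_integrable_diff_const(2)[OF intR fm(1)] set_integrable_diff_const(2)[OF int fmeasurable_cube[OF b(1)]] b(2)
    unfolding set_integrable_def set_lebesgue_integral_def
    by (intro integral_mono) (auto simp: indicator_def)
  also have "\<dots> \<le> \<beta> * measure \<mu> (cube b s)" by (rule osc[OF b(1)])
  also have "\<dots> \<le> \<beta> * (D * measure \<mu> R)" using b(3) \<beta> by (rule mult_left_mono)
  finally show ?thesis by (simp add: mult_ac)
qed

text \<open>The abstract bound applied to the cells of the first \<open>N\<close> levels. The function \<open>v\<close> stands for the
  maximal function of the weight; one factor \<open>D\<close> comes from replacing a cell by a comparable cube in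
  the oscillation, one from the passage to the parent cell, and one from replacing a cell by a cube in
  the average of \<open>w\<close>.\<close>

lemma dyadic_mean_weighted_bound:
  fixes w v :: "real ^ 'n \<Rightarrow> ennreal"
  assumes l: "0 < l" and f: "locally_integrable \<mu> f" and \<beta>: "0 < \<beta>"
    and osc: "\<And>b s. 0 < s \<Longrightarrow>
      (LINT x:cube b s|\<mu>. \<bar>f x - average \<mu> f (cube b s)\<bar>) \<le> \<beta> * measure \<mu> (cube b s)"
    and w: "w \<in> borel_measurable \<mu>" and v: "v \<in> borel_measurable \<mu>"
    and dom: "\<And>b s x. 0 < s \<Longrightarrow> cube b s \<subseteq> cube a l \<Longrightarrow> x \<in> cube b s \<Longrightarrow>
      (\<integral>\<^sup>+y\<in>cube b s. w y \<partial>\<mu>) \<le> v x * emeasure \<mu> (cube b s)"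
  shows "(\<integral>\<^sup>+x\<in>cube a l. w x * ennreal \<bar>dyadic_mean a l f N x - average \<mu> f (cube a l)\<bar> \<partial>\<mu>)
    \<le> ennreal (12 * D ^ 3 * \<beta>) * (\<integral>\<^sup>+x\<in>cube a l. v x \<partial>\<mu>)"
proof -
  note cell = dyadic_cells_fmeasurable[OF l]
  note cell_osc = dyadic_cell_oscillation[OF l f osc less_imp_le[OF \<beta>]]
  define F where "F = (\<Union>k\<in>{..N}. dyadic_cells a l k)"
  have finF: "finite F" unfolding F_def using finite_dyadic_cells[OF l] by blast
  have F: "\<exists>k\<le>N. P \<in> dyadic_cells a l k" if "P \<in> F" for P
    using that by (auto simp: F_def)
  have FI: "P \<in> F" if "P \<in> dyadic_cells a l k" "k \<le> N" for P k
    using that by (auto simp: F_def)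
  have int: "set_integrable \<mu> P f" if "P \<in> dyadic_cells a l k" for P k
    using cell[OF that] that Union_dyadic_cells[of a l k] f
    by (intro set_integrable_subset_cube[of f _ a l]) (auto simp: fmeasurable_def sets_mu)
  define C where "C = 2 * D ^ 2 * \<beta>"
  have C: "2 * D * \<beta> \<le> C"
    using D_ge_1 \<beta> by (simp add: C_def power2_eq_square mult_le_cancel_right)
  have top: "cube a l \<in> dyadic_cells a l 0"
    using dyadic_cell_0[OF l] corner_mem_cube[of l a] l by (force simp: dyadic_cells_def)
  have "(\<integral>\<^sup>+x\<in>cube a l. w x * ennreal \<bar>dyadic_mean a l f N x - average \<mu> f (cube a l)\<bar> \<partial>\<mu>)
    \<le> ennreal (6 * C) * (\<integral>\<^sup>+x\<in>cube a l. ennreal D * v x \<partial>\<mu>)"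
  proof (rule laminar_family_bound[where F = F and h = "average \<mu> f"])
    show "finite F" by (rule finF)
    show "P \<in> fmeasurable \<mu>" "0 < measure \<mu> P" if "P \<in> F" for P
      using F[OF that] cell by blast+
    show "P \<subseteq> R \<or> R \<subseteq> P \<or> P \<inter> R = {}" if PR: "P \<in> F" "R \<in> F" for P R
    proof -
      obtain j k where jk: "P \<in> dyadic_cells a l j" "R \<in> dyadic_cells a l k"
        using F[OF PR(1)] F[OF PR(2)] by blast
      show ?thesis
        using dyadic_cells_nested[OF jk(1,2)] dyadic_cells_nested[OF jk(2,1)] linear[of j k] by blast
    qed
    show "\<exists>R'\<in>F. R \<subset> R' \<and> R' \<subseteq> P \<and> \<bar>average \<mu> f R - average \<mu> f R'\<bar> \<le> C"
      if PR: "P \<in> F" "R \<in> F" "R \<subset> P" for P R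
    proof -
      obtain j where j: "P \<in> dyadic_cells a l j" using F[OF PR(1)] by blast
      obtain k where k: "R \<in> dyadic_cells a l k" "k \<le> N" using F[OF PR(2)] by blast
      \<comment> \<open>a priori one set may be a cell of several levels; the parent at the coarsest of them is strictly larger\<close>
      define m where "m = (LEAST m. R \<in> dyadic_cells a l m)"
      have m: "R \<in> dyadic_cells a l m" unfolding m_def using k(1) by (rule LeastI)
      have m_le: "m \<le> i" if "R \<in> dyadic_cells a l i" for i unfolding m_def using that by (rule Least_le)
      obtain x where x: "x \<in> cube a l" "R = dyadic_cell a l m x" using m by (auto simp: dyadic_cells_def)
      have "x \<in> P" using mem_dyadic_cell[OF x(1), of m] x(2) PR(3) by blast
      then have P: "P = dyadic_cell a l j x" using j by (rule mem_dyadic_cellsD)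
      have "j < m"
      proof (rule ccontr)
        assume "\<not> j < m"
        then have "P \<subseteq> R" unfolding P x(2) by (intro dyadic_cell_antimono) simp
        with PR(3) show False by blast
      qed
      then obtain i where i: "m = Suc i" "j \<le> i" by (cases m) auto
      let ?R' = "dyadic_cell a l i x"
      have R': "?R' \<in> dyadic_cells a l i" using x(1) by (auto simp: dyadic_cells_def)
      have "R \<noteq> ?R'" using m_le[of i] R' i(1) by auto
      moreover have RR': "R \<subseteq> ?R'" unfolding x(2) i(1) by (rule dyadic_cell_antimono) simp
      ultimately have "R \<subset> ?R'" by blast
      moreover have "?R' \<subseteq> P" unfolding P using i(2) by (rule dyadic_cell_antimono)
      moreover have "?R' \<in> F" using FI[OF R'] m_le[OF k(1)] k(2) i(1) by simp
      moreover have "\<bar>average \<mu> f R - average \<mu> f ?R'\<bar> \<le> C"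
      proof -
        have "measure \<mu> R * \<bar>average \<mu> f R - average \<mu> f ?R'\<bar> \<le> (LINT x:R|\<mu>. \<bar>f x - average \<mu> f ?R'\<bar>)"
          using cell[OF m] int[OF m] by (intro measure_mult_average_diff_le)
        also have "\<dots> \<le> (LINT x:?R'|\<mu>. \<bar>f x - average \<mu> f ?R'\<bar>)"
          using set_integrable_diff_const(2)[OF int[OF m] cell(1)[OF m]]
            set_integrable_diff_const(2)[OF int[OF R'] cell(1)[OF R']] RR'
          unfolding set_integrable_def set_lebesgue_integral_def
          by (intro integral_mono) (auto simp: indicator_def)
        also have "\<dots> \<le> 2 * D * \<beta> * measure \<mu> ?R'" by (rule cell_osc[OF _ R'])
        also have "\<dots> \<le> 2 * D * \<beta> * (D * measure \<mu> R)"
          using measure_dyadic_parent_le[OF l x(1), of i] D_ge_1 \<beta> unfolding x(2) i(1)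
          by (intro mult_left_mono) auto
        finally have "measure \<mu> R * \<bar>average \<mu> f R - average \<mu> f ?R'\<bar> \<le> measure \<mu> R * C"
          by (simp add: C_def power2_eq_square mult_ac)
        then show ?thesis using cell(2)[OF m] by simp
      qed
      ultimately show ?thesis by blast
    qed
    show "(\<Sum>R\<in>S. measure \<mu> R * \<bar>average \<mu> f R - average \<mu> f P\<bar>) \<le> C * measure \<mu> P"
      if PS: "P \<in> F" "S \<subseteq> F" "pairwise disjnt S" "\<Union>S \<subseteq> P" for P S
    proof -
      obtain j where j: "P \<in> dyadic_cells a l j" using F[OF PS(1)] by blast
      have S: "R \<in> fmeasurable \<mu> \<and> 0 < measure \<mu> R \<and> set_integrable \<mu> R f" if "R \<in> S" for R
        using F[of R] PS(2) that cell int by blast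
      have finS: "finite S"
        using PS(2) finF by (rule finite_subset)
      let ?c = "average \<mu> f P"
      have "(\<Sum>R\<in>S. measure \<mu> R * \<bar>average \<mu> f R - ?c\<bar>) \<le> (\<Sum>R\<in>S. LINT x:R|\<mu>. \<bar>f x - ?c\<bar>)"
        using S by (intro sum_mono measure_mult_average_diff_le) auto
      also have "\<dots> = (LINT x:(\<Union>R\<in>S. R)|\<mu>. \<bar>f x - ?c\<bar>)"
        using finS PS(3) S
        by (subst set_integral_finite_Union)
          (auto simp: disjoint_family_on_def pairwise_def disjnt_def fmeasurableD intro: set_integrable_diff_const)
      also have "\<dots> \<le> (LINT x:P|\<mu>. \<bar>f x - ?c\<bar>)"
      proof -
        have intP: "set_integrable \<mu> P (\<lambda>x. \<bar>f x - ?c\<bar>)"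
          using int[OF j] cell(1)[OF j] by (rule set_integrable_diff_const)
        moreover have "set_integrable \<mu> (\<Union>R\<in>S. R) (\<lambda>x. \<bar>f x - ?c\<bar>)"
          using finS S PS(4) by (intro set_integrable_subset[OF intP] sets.finite_UN) (auto simp: fmeasurable_def)
        ultimately show ?thesis
          using PS(4) unfolding set_integrable_def set_lebesgue_integral_def
          by (intro integral_mono) (auto simp: indicator_def)
      qed
      also have "\<dots> \<le> 2 * D * \<beta> * measure \<mu> P" by (rule cell_osc[OF _ j])
      also have "\<dots> \<le> C * measure \<mu> P" using C by (rule mult_right_mono) simp
      finally show ?thesis .
    qed
    show "\<exists>R\<in>F. x \<in> R \<and> R \<subseteq> P \<and> dyadic_mean a l f N x = average \<mu> f R" if Px: "P \<in> F" "x \<in> P" for P x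
    proof -
      obtain j where j: "P \<in> dyadic_cells a l j" "j \<le> N" using F[OF Px(1)] by blast
      have x: "x \<in> cube a l" using j(1) Px(2) Union_dyadic_cells[of a l j] by blast
      have R: "dyadic_cell a l N x \<in> dyadic_cells a l N" using x by (auto simp: dyadic_cells_def)
      have "dyadic_cell a l N x \<subseteq> P"
        using dyadic_cell_antimono[OF j(2), of a l x] mem_dyadic_cellsD[OF Px(2) j(1)] by simp
      moreover have "dyadic_mean a l f N x = average \<mu> f (dyadic_cell a l N x)"
        by (rule dyadic_mean_eq[OF l R mem_dyadic_cell[OF x]])
      ultimately show ?thesis using FI[OF R] mem_dyadic_cell[OF x] by blast
    qed
    show "0 < C" using D_ge_1 \<beta> by (simp add: C_def)
    show "w \<in> borel_measurable \<mu>" by (rule w)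
    show "(\<lambda>x. ennreal D * v x) \<in> borel_measurable \<mu>" using v by simp
    show "dyadic_mean a l f N \<in> borel_measurable \<mu>" by (rule borel_dyadic_mean[OF l])
    show "(\<integral>\<^sup>+y\<in>P. w y \<partial>\<mu>) \<le> ennreal D * v x * emeasure \<mu> P" if Px: "P \<in> F" "x \<in> P" for P x
    proof -
      obtain j where j: "P \<in> dyadic_cells a l j" using F[OF Px(1)] by blast
      obtain b s where b: "0 < s" "P \<subseteq> cube b s" "cube b s \<subseteq> cube a l" "measure \<mu> (cube b s) \<le> D * measure \<mu> P"
        by (rule dyadic_cell_in_comparable_cube[OF l j])
      have "(\<integral>\<^sup>+y\<in>P. w y \<partial>\<mu>) \<le> (\<integral>\<^sup>+y\<in>cube b s. w y \<partial>\<mu>)"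
        using b(2) by (intro nn_integral_mono) (auto simp: indicator_def)
      also have "\<dots> \<le> v x * emeasure \<mu> (cube b s)" using b Px(2) by (intro dom) auto
      also have "\<dots> \<le> v x * (ennreal D * emeasure \<mu> P)"
        using b(4) cell(1)[OF j] b(1) D_ge_1
        by (intro mult_left_mono)
          (auto simp: emeasure_cube emeasure_eq_measure2 ennreal_mult[symmetric] intro!: ennreal_leI)
      finally show ?thesis by (simp add: mult_ac)
    qed
    show "cube a l \<in> F" using FI[OF top] by simp
  qed
  also have "(\<integral>\<^sup>+x\<in>cube a l. ennreal D * v x \<partial>\<mu>) = ennreal D * (\<integral>\<^sup>+x\<in>cube a l. v x \<partial>\<mu>)"
    using v by (subst nn_integral_cmult[symmetric]) (auto simp: mult_ac)
  also have "ennreal (6 * C) * (ennreal D * (\<integral>\<^sup>+x\<in>cube a l. v x \<partial>\<mu>)) =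
      ennreal (12 * D ^ 3 * \<beta>) * (\<integral>\<^sup>+x\<in>cube a l. v x \<partial>\<mu>)"
  proof -
    have "ennreal (6 * C) * ennreal D = ennreal (12 * D ^ 3 * \<beta>)"
      using D_ge_1 \<beta> by (subst ennreal_mult[symmetric]) (auto simp: C_def power2_eq_square power3_eq_cube mult_ac)
    then show ?thesis by (simp add: mult.assoc[symmetric])
  qed
  finally show ?thesis .
qed

text \<open>The bound for the dyadic means does not depend on the level, so it passes to the function itself by
  Fatou's lemma along a subsequence of levels.\<close>

theorem weighted_oscillation_bound:
  fixes w v :: "real ^ 'n \<Rightarrow> ennreal"
  assumes l: "0 < l" and f: "locally_integrable \<mu> f" and \<beta>: "0 < \<beta>"
    and osc: "\<And>b s. 0 < s \<Longrightarrow>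
      (LINT x:cube b s|\<mu>. \<bar>f x - average \<mu> f (cube b s)\<bar>) \<le> \<beta> * measure \<mu> (cube b s)"
    and w [measurable]: "w \<in> borel_measurable \<mu>" and w_fin: "\<And>x. w x < \<infinity>"
    and v: "v \<in> borel_measurable \<mu>"
    and dom: "\<And>b s x. 0 < s \<Longrightarrow> cube b s \<subseteq> cube a l \<Longrightarrow> x \<in> cube b s \<Longrightarrow>
      (\<integral>\<^sup>+y\<in>cube b s. w y \<partial>\<mu>) \<le> v x * emeasure \<mu> (cube b s)"
  shows "(\<integral>\<^sup>+x\<in>cube a l. w x * ennreal \<bar>f x - average \<mu> f (cube a l)\<bar> \<partial>\<mu>)
    \<le> ennreal (12 * D ^ 3 * \<beta>) * (\<integral>\<^sup>+x\<in>cube a l. v x \<partial>\<mu>)"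
proof -
  let ?X = "cube a l" and ?m = "average \<mu> f (cube a l)"
  have int: "set_integrable \<mu> ?X f" using f by (intro set_integrable_subset_cube[of f _ a l]) auto
  obtain r :: "nat \<Rightarrow> nat" where r: "AE x in \<mu>. x \<in> ?X \<longrightarrow> (\<lambda>k. dyadic_mean a l f (r k) x) \<longlonglongrightarrow> f x"
    by (rule dyadic_mean_AE_subseq[OF l int])
  let ?u = "\<lambda>k x. w x * ennreal \<bar>dyadic_mean a l f (r k) x - ?m\<bar> * indicator ?X x"
  have [measurable]: "dyadic_mean a l f k \<in> borel_measurable \<mu>" for k by (rule borel_dyadic_mean[OF l])
  have "(\<integral>\<^sup>+x\<in>?X. w x * ennreal \<bar>f x - ?m\<bar> \<partial>\<mu>) \<le> (\<integral>\<^sup>+x. liminf (\<lambda>k. ?u k x) \<partial>\<mu>)"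
  proof (rule nn_integral_mono_AE)
    from r show "AE x in \<mu>. w x * ennreal \<bar>f x - ?m\<bar> * indicator ?X x \<le> liminf (\<lambda>k. ?u k x)"
    proof eventually_elim
      case (elim x)
      show ?case
      proof (cases "x \<in> ?X")
        case True
        with elim have lim: "(\<lambda>k. dyadic_mean a l f (r k) x) \<longlonglongrightarrow> f x" by simp
        have "w x < top" using w_fin[of x] by simp
        then have "(\<lambda>k. w x * ennreal \<bar>dyadic_mean a l f (r k) x - ?m\<bar>) \<longlonglongrightarrow> w x * ennreal \<bar>f x - ?m\<bar>"
          by (intro ennreal_tendsto_cmult tendsto_ennrealI tendsto_rabs tendsto_diff tendsto_const lim)
        then have "liminf (\<lambda>k. w x * ennreal \<bar>dyadic_mean a l f (r k) x - ?m\<bar>) = w x * ennreal \<bar>f x - ?m\<bar>"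
          by (intro lim_imp_Liminf) auto
        with True show ?thesis by simp
      qed simp
    qed
  qed
  also have "\<dots> \<le> liminf (\<lambda>k. \<integral>\<^sup>+x. ?u k x \<partial>\<mu>)"
    by (intro nn_integral_liminf) measurable
  also have "\<dots> \<le> liminf (\<lambda>k::nat. ennreal (12 * D ^ 3 * \<beta>) * (\<integral>\<^sup>+x\<in>cube a l. v x \<partial>\<mu>))"
    using dyadic_mean_weighted_bound[OF l f \<beta> osc w v dom]
    by (intro Liminf_mono always_eventually allI)
  also have "\<dots> = ennreal (12 * D ^ 3 * \<beta>) * (\<integral>\<^sup>+x\<in>cube a l. v x \<partial>\<mu>)"
    by (intro Liminf_const) simp
  finally show ?thesis .
qed

end

section \<open>The maximal operator\<close>

context doubling_cubes
begin

lemma measure_inflated_cube_tendsto: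
  assumes l: "0 < l"
  shows "(\<lambda>j. measure \<mu> (cube (\<chi> i. a $ i - 1 / Suc j) (l + 3 / Suc j))) \<longlonglongrightarrow> measure \<mu> (cube a l)"
proof -
  define A where "A j = cube (\<chi> i. a $ i - 1 / real (Suc j)) (l + 3 / real (Suc j))" for j
  have mem: "x \<in> A j \<longleftrightarrow> (\<forall>i. a $ i - 1 / Suc j \<le> x $ i \<and> x $ i \<le> a $ i + l + 2 / Suc j)" for x j
  proof -
    have "3 / real (Suc j) = 1 / real (Suc j) + 2 / real (Suc j)"
      by (simp only: add_divide_distrib[symmetric]) simp
    then have "a $ i - 1 / real (Suc j) + (l + 3 / real (Suc j)) = a $ i + l + 2 / real (Suc j)" for i
      by linarith
    then show ?thesis by (simp only: A_def mem_cube vec_lambda_beta)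
  qed
  have "decseq A"
  proof (rule decseq_SucI, rule subsetI)
    fix j x assume x: "x \<in> A (Suc j)"
    have "1 / real (Suc (Suc j)) \<le> 1 / Suc j" "2 / real (Suc (Suc j)) \<le> 2 / Suc j"
      by (auto intro!: divide_left_mono)
    with x show "x \<in> A j" unfolding mem by (smt (verit))
  qed
  moreover have "(\<Inter>j. A j) = cube a l"
  proof (intro equalityI subsetI)
    fix x assume x: "x \<in> (\<Inter>j. A j)"
    have lim: "(\<lambda>j. c / real (Suc j)) \<longlonglongrightarrow> 0" for c
      using tendsto_mult[OF tendsto_const[of c] LIMSEQ_inverse_real_of_nat] by (simp add: divide_inverse)
    show "x \<in> cube a l"
      unfolding mem_cube
    proof
      fix i
      have "a $ i - 1 / Suc j \<le> x $ i" "x $ i \<le> a $ i + l + 2 / Suc j" for j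
        using x mem[of x j] by auto
      moreover have "(\<lambda>j. a $ i - 1 / Suc j) \<longlonglongrightarrow> a $ i - 0" "(\<lambda>j. a $ i + l + 2 / Suc j) \<longlonglongrightarrow> a $ i + l + 0"
        by (intro tendsto_intros lim)+
      ultimately show "a $ i \<le> x $ i \<and> x $ i \<le> a $ i + l"
        using LIMSEQ_le_const2[of _ "a $ i - 0" "x $ i"] LIMSEQ_le_const[of _ "a $ i + l + 0" "x $ i"] by simp
    qed
  next
    fix x assume x: "x \<in> cube a l"
    have pos: "0 \<le> 1 / real (Suc j)" "0 \<le> 2 / real (Suc j)" for j by simp_all
    have "x \<in> A j" for j
      unfolding mem
    proof
      fix i
      have "a $ i \<le> x $ i" "x $ i \<le> a $ i + l" using x by (simp_all add: mem_cube)
      with pos[of j] show "a $ i - 1 / Suc j \<le> x $ i \<and> x $ i \<le> a $ i + l + 2 / Suc j" by linarith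
    qed
    then show "x \<in> (\<Inter>j. A j)" by blast
  qed
  moreover have A: "A j \<in> fmeasurable \<mu>" for j
    unfolding A_def using l by (intro fmeasurable_cube) (simp add: add_pos_pos)
  moreover have "range A \<subseteq> sets \<mu>" using A by (auto simp: fmeasurable_def)
  ultimately have "(\<lambda>j. measure \<mu> (A j)) \<longlonglongrightarrow> measure \<mu> (cube a l)"
    using Lim_measure_decseq[of A \<mu>] by (simp add: fmeasurable_def less_top)
  then show ?thesis by (simp add: A_def)
qed

text \<open>Countably many cubes suffice in the definition of the maximal operator, because a slight
  enlargement of a cube changes its measure only slightly. This gives measurability, and it lets the
  maximal function be approximated by maxima over finitely many cubes.\<close>

theorem maximal_countable_cubes:
  "\<exists>Q :: nat \<Rightarrow> (real ^ 'n) set. (\<forall>j. Q j \<in> cubes) \<and>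
     (\<forall>g x. maximal \<mu> g x =
       (SUP j. (\<integral>\<^sup>+y\<in>Q j. ennreal \<bar>g y\<bar> \<partial>\<mu>) / emeasure \<mu> (Q j) * indicator (Q j) x))"
proof -
  obtain S :: "(real ^ 'n) set" where S: "countable S" "\<And>U. open U \<Longrightarrow> U \<noteq> {} \<Longrightarrow> \<exists>d\<in>S. d \<in> U"
    using countable_dense_exists[where 'a = "real ^ 'n"] by blast
  define C where "C = (\<lambda>(d, r). cube d r) ` (S \<times> (\<rat> \<inter> {0<..}))"
  have "countable C"
    unfolding C_def using S(1) countable_rat by (intro countable_image countable_SIGMA countable_Int1) auto
  have C_cubes: "Q \<in> cubes" if "Q \<in> C" for Q
    using that by (auto simp: C_def cubes_def)
  have between: "\<exists>Q\<in>C. cube a l \<subseteq> Q \<and> Q \<subseteq> cube (\<chi> i. a $ i - e) (l + 3 * e)"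
    if le: "0 < l" "0 < e" for a :: "real ^ 'n" and l e
  proof -
    have "box (\<chi> i. a $ i - e) a \<noteq> {}" using le(2) by (simp add: interval_ne_empty_cart)
    then obtain d where d: "d \<in> S" "d \<in> box (\<chi> i. a $ i - e) a" using S(2)[OF open_box] by blast
    then have d': "a $ i - e < d $ i" "d $ i < a $ i" for i by (auto simp: mem_box_cart)
    obtain r where r: "r \<in> \<rat>" "l + e < r" "r < l + 2 * e"
      using Rats_dense_in_real[of "l + e" "l + 2 * e"] le(2) by auto
    have "cube a l \<subseteq> cube d r"
    proof
      fix x assume "x \<in> cube a l"
      then have "a $ i \<le> x $ i" "x $ i \<le> a $ i + l" for i by (simp_all add: mem_cube)
      with d' r show "x \<in> cube d r" unfolding mem_cube by (smt (verit))
    qed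
    moreover have "cube d r \<subseteq> cube (\<chi> i. a $ i - e) (l + 3 * e)"
    proof
      fix x assume "x \<in> cube d r"
      then have "d $ i \<le> x $ i" "x $ i \<le> d $ i + r" for i by (simp_all add: mem_cube)
      with d' r show "x \<in> cube (\<chi> i. a $ i - e) (l + 3 * e)" unfolding mem_cube vec_lambda_beta by (smt (verit))
    qed
    moreover have "cube d r \<in> C" using d(1) r le by (force simp: C_def)
    ultimately show ?thesis by blast
  qed
  have "C \<noteq> {}" using between[of 1 1] by auto
  define Q where "Q = from_nat_into C"
  have range_Q: "range Q = C" unfolding Q_def using \<open>C \<noteq> {}\<close> \<open>countable C\<close> by (rule range_from_nat_into)
  have "maximal \<mu> g x =
      (SUP j. (\<integral>\<^sup>+y\<in>Q j. ennreal \<bar>g y\<bar> \<partial>\<mu>) / emeasure \<mu> (Q j) * indicator (Q j) x)" (is "_ = ?R") for g x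
  proof (rule antisym)
    show "maximal \<mu> g x \<le> ?R"
      unfolding maximal_def
    proof (rule SUP_least)
      fix P assume P: "P \<in> {P \<in> cubes. x \<in> P}"
      then obtain a l where l: "0 < l" and P_eq: "P = cube a l" by (auto elim: cubes_cases)
      let ?I = "\<integral>\<^sup>+y\<in>P. ennreal \<bar>g y\<bar> \<partial>\<mu>"
      define A where "A j = cube (\<chi> i. a $ i - 1 / real (Suc j)) (l + 3 / real (Suc j))" for j
      have lA: "0 < l + 3 / real (Suc j)" for j using l by (simp add: add_pos_pos)
      have "?I * ennreal (1 / measure \<mu> (A j)) \<le> ?R" for j
      proof -
        obtain Q' where Q': "Q' \<in> C" "P \<subseteq> Q'" "Q' \<subseteq> A j"
          using between[OF l, of "1 / real (Suc j)" a] by (auto simp: A_def P_eq)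
        obtain b s where s: "0 < s" "Q' = cube b s" using C_cubes[OF Q'(1)] by (rule cubes_cases)
        have "measure \<mu> Q' \<le> measure \<mu> (A j)"
          using Q'(3) fmeasurable_cube[OF lA] by (intro measure_mono_fmeasurable) (auto simp: A_def s)
        then have "1 / measure \<mu> (A j) \<le> 1 / measure \<mu> Q'"
          using measure_cube_pos[OF s(1), of b] by (intro divide_left_mono) (auto simp: s(2))
        then have "?I * ennreal (1 / measure \<mu> (A j)) \<le> (\<integral>\<^sup>+y\<in>Q'. ennreal \<bar>g y\<bar> \<partial>\<mu>) * ennreal (1 / measure \<mu> Q')"
          using Q'(2) by (intro mult_mono nn_integral_mono ennreal_leI) (auto simp: indicator_def)
        also have "\<dots> = (\<integral>\<^sup>+y\<in>Q'. ennreal \<bar>g y\<bar> \<partial>\<mu>) / emeasure \<mu> Q' * indicator Q' x"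
          using P Q'(2) measure_cube_pos[OF s(1), of b]
          by (auto simp: s emeasure_cube divide_ennreal_def inverse_ennreal divide_inverse)
        also have "\<dots> \<le> ?R"
        proof -
          obtain i where "Q' = Q i" using Q'(1) range_Q by blast
          then show ?thesis by (simp only:) (rule SUP_upper, simp)
        qed
        finally show ?thesis .
      qed
      moreover have "(\<lambda>j. ?I * ennreal (1 / measure \<mu> (A j))) \<longlonglongrightarrow> ?I * ennreal (1 / measure \<mu> P)"
      proof (rule tendsto_mult_ennreal[OF tendsto_const tendsto_ennrealI])
        show "(\<lambda>j. 1 / measure \<mu> (A j)) \<longlonglongrightarrow> 1 / measure \<mu> P"
          unfolding A_def P_eq using measure_cube_pos[OF l, of a]
          by (intro tendsto_divide tendsto_const measure_inflated_cube_tendsto l) auto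
        show "\<not> (?I = 0 \<and> ennreal (1 / measure \<mu> P) = \<infinity> \<or> ?I = \<infinity> \<and> ennreal (1 / measure \<mu> P) = 0)"
          using measure_cube_pos[OF l, of a] by (simp add: P_eq ennreal_eq_0_iff not_le)
      qed
      ultimately have "?I * ennreal (1 / measure \<mu> P) \<le> ?R"
        by (intro LIMSEQ_le_const2) auto
      then show "?I / emeasure \<mu> P \<le> ?R"
        using measure_cube_pos[OF l, of a]
        by (simp add: P_eq emeasure_cube[OF l] divide_ennreal_def inverse_ennreal divide_inverse)
    qed
    show "?R \<le> maximal \<mu> g x"
    proof (rule SUP_least)
      fix j
      have "Q j \<in> cubes" using C_cubes range_Q by blast
      then show "(\<integral>\<^sup>+y\<in>Q j. ennreal \<bar>g y\<bar> \<partial>\<mu>) / emeasure \<mu> (Q j) * indicator (Q j) x \<le> maximal \<mu> g x"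
        unfolding maximal_def by (cases "x \<in> Q j") (auto intro: SUP_upper)
    qed
  qed
  moreover have "Q j \<in> cubes" for j using C_cubes range_Q by blast
  ultimately show ?thesis by blast
qed

lemma borel_maximal [measurable]: "maximal \<mu> g \<in> borel_measurable \<mu>"
proof -
  obtain Q :: "nat \<Rightarrow> (real ^ 'n) set" where Q: "\<And>j. Q j \<in> cubes" and
    eq: "\<And>g x. maximal \<mu> g x =
       (SUP j. (\<integral>\<^sup>+y\<in>Q j. ennreal \<bar>g y\<bar> \<partial>\<mu>) / emeasure \<mu> (Q j) * indicator (Q j) x)"
    using maximal_countable_cubes by blast
  have [measurable]: "Q j \<in> sets \<mu>" for j
    using Q[of j] by (auto elim: cubes_cases)
  show ?thesis
    unfolding eq[abs_def] by measurable
qed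

lemma integral_cube_le_maximal:
  assumes "0 < l" "x \<in> cube a l"
  shows "(\<integral>\<^sup>+y\<in>cube a l. ennreal \<bar>g y\<bar> \<partial>\<mu>) \<le> maximal \<mu> g x * emeasure \<mu> (cube a l)"
proof -
  let ?I = "\<integral>\<^sup>+y\<in>cube a l. ennreal \<bar>g y\<bar> \<partial>\<mu>"
  have "?I / emeasure \<mu> (cube a l) \<le> maximal \<mu> g x"
    unfolding maximal_def using assms by (intro SUP_upper) (auto simp: cube_in_cubes)
  then have "?I / emeasure \<mu> (cube a l) * emeasure \<mu> (cube a l) \<le> maximal \<mu> g x * emeasure \<mu> (cube a l)"
    by (rule mult_right_mono) simp
  then show ?thesis
    using cube_pos[OF assms(1), of a] cube_finite[OF assms(1), of a]
    by (simp add: ennreal_divide_times ennreal_divide_self)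
qed

end

text \<open>A maximum of finitely many multiples of indicators is at most a combination of the same
  multiples over disjoint sets: each point is assigned to a set that attains the maximum there.\<close>

lemma finite_max_le_disjoint_sum:
  fixes c :: "nat \<Rightarrow> ennreal"
  assumes X: "X \<in> sets M" and R: "\<And>j. R j \<in> sets M"
  shows "\<exists>E. disjoint_family_on E {..<N} \<and> (\<forall>j<N. E j \<in> sets M \<and> E j \<subseteq> X \<inter> R j) \<and>
    (\<forall>x\<in>X. (SUP j\<in>{..<N}. c j * indicator (R j) x) \<le> (\<Sum>j<N. c j * indicator (E j) x))"
proof (induction N)
  case 0
  show ?case by (simp add: disjoint_family_on_def bot_ennreal)
next
  case (Suc N)
  then obtain E where disj: "disjoint_family_on E {..<N}"
    and E: "\<And>j. j < N \<Longrightarrow> E j \<in> sets M" "\<And>j. j < N \<Longrightarrow> E j \<subseteq> X \<inter> R j"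
    and le: "\<And>x. x \<in> X \<Longrightarrow> (SUP j\<in>{..<N}. c j * indicator (R j) x) \<le> (\<Sum>j<N. c j * indicator (E j) x)"
    by blast
  define m where "m x = (SUP j\<in>{..<N}. c j * indicator (R j) x)" for x
  have [measurable]: "m \<in> borel_measurable M"
    unfolding m_def using R by (intro borel_measurable_SUP) auto
  define A where "A = {x \<in> space M. m x < c N} \<inter> (X \<inter> R N)"
  have A: "A \<in> sets M" unfolding A_def using X R by (intro sets.Int) measurable
  define E' where "E' j = (if j = N then A else E j - A)" for j
  have "disjoint_family_on E' {..<Suc N}"
    unfolding disjoint_family_on_def
  proof (intro ballI impI)
    fix i j assume ij: "i \<in> {..<Suc N}" "j \<in> {..<Suc N}" "i \<noteq> j"
    then have "i < N \<Longrightarrow> j < N \<Longrightarrow> E i \<inter> E j = {}"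
      using disj by (simp add: disjoint_family_on_def)
    with ij show "E' i \<inter> E' j = {}"
      unfolding E'_def by (cases "i = N"; cases "j = N") (auto simp: less_Suc_eq disjoint_iff)
  qed
  moreover have "E' j \<in> sets M \<and> E' j \<subseteq> X \<inter> R j" if "j < Suc N" for j
    using that A E[of j] by (auto simp: E'_def A_def less_Suc_eq)
  moreover have "(SUP j\<in>{..<Suc N}. c j * indicator (R j) x) \<le> (\<Sum>j<Suc N. c j * indicator (E' j) x)"
    if x: "x \<in> X" for x
  proof -
    have SUP: "(SUP j\<in>{..<Suc N}. c j * indicator (R j) x) = sup (c N * indicator (R N) x) (m x)"
      by (simp add: lessThan_Suc m_def)
    have sum: "(\<Sum>j<Suc N. c j * indicator (E' j) x) = c N * indicator A x + (\<Sum>j<N. c j * indicator (E j - A) x)"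
      by (simp add: E'_def add.commute)
    show ?thesis
    proof (cases "x \<in> A")
      case True
      then have "m x < c N" "x \<in> R N" by (auto simp: A_def)
      with True show ?thesis unfolding SUP sum by (simp add: sup_absorb1)
    next
      case False
      have "x \<in> space M" using x X sets.sets_into_space by blast
      with False x have "c N * indicator (R N) x \<le> m x" by (auto simp: A_def not_less indicator_def)
      moreover have "m x \<le> (\<Sum>j<N. c j * indicator (E j - A) x)"
        using le[OF x] False by (simp add: m_def indicator_def)
      ultimately show ?thesis unfolding SUP sum using False by simp
    qed
  qed
  ultimately show ?case by blast
qed

section \<open>Balayage of disjoint sets\<close>

text \<open>A Lipschitz substitute for the indicator of a cube. Indicators would not do below: the boundaries
  of cubes of infinitely many sizes can pass through one small cube, and their jumps would add up,
  whereas the oscillation of a bump on a cube of side \<open>s\<close> is of order \<open>s / l\<close>.\<close>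

definition bump :: "real ^ 'n \<Rightarrow> real \<Rightarrow> real ^ 'n \<Rightarrow> real" where
  "bump a l y = max 0 (1 - infdist y (cube a l) / l)"

lemma bump_nonneg: "0 \<le> bump a l y"
  by (simp add: bump_def)

lemma bump_le_1: "0 < l \<Longrightarrow> bump a l y \<le> 1"
  by (simp add: bump_def infdist_nonneg)

lemma bump_eq_1: "y \<in> cube a l \<Longrightarrow> bump a l y = 1"
  by (simp add: bump_def)

lemma bump_support:
  assumes l: "0 < l" and y: "bump a l y \<noteq> 0"
  shows "y \<in> cube (\<chi> i. a $ i - l) (3 * l)"
proof -
  have ne: "cube a l \<noteq> {}" using corner_mem_cube[of l a] l by auto
  have "infdist y (cube a l) < l" using y l by (simp add: bump_def max_def pos_divide_less_eq split: if_splits)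
  then obtain p where p: "p \<in> cube a l" "dist y p < l"
    using ne cInf_lessD[of "dist y ` cube a l" l] by (auto simp: infdist_def)
  show ?thesis
    unfolding mem_cube vec_lambda_beta
  proof
    fix i
    have "a $ i \<le> p $ i" "p $ i \<le> a $ i + l" using p(1) by (simp_all add: mem_cube)
    moreover have "\<bar>y $ i - p $ i\<bar> < l"
      using component_le_norm_cart[of "y - p" i] p(2) by (simp add: dist_norm)
    ultimately show "a $ i - l \<le> y $ i \<and> y $ i \<le> a $ i - l + 3 * l" by linarith
  qed
qed

lemma bump_lipschitz:
  assumes "0 < l"
  shows "\<bar>bump a l y - bump a l z\<bar> \<le> dist y z / l"
proof -
  have "\<bar>bump a l y - bump a l z\<bar> \<le> \<bar>infdist z (cube a l) / l - infdist y (cube a l) / l\<bar>"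
    by (simp add: bump_def)
  also have "\<dots> = \<bar>infdist z (cube a l) - infdist y (cube a l)\<bar> / l"
    using assms by (simp add: diff_divide_distrib[symmetric])
  also have "\<dots> \<le> dist y z / l"
    using assms infdist_triangle_abs[of z "cube a l" y] by (simp add: divide_right_mono dist_commute)
  finally show ?thesis .
qed

lemma borel_bump [measurable]: "bump a l \<in> borel_measurable borel"
proof -
  have "continuous_on UNIV (\<lambda>y. infdist y (cube a l))"
    by (intro continuous_on_infdist continuous_on_id)
  then have [measurable]: "(\<lambda>y. infdist y (cube a l)) \<in> borel_measurable borel"
    by (rule borel_measurable_continuous_onI)
  show ?thesis unfolding bump_def[abs_def] by measurable
qed

lemma cube_subset_inflated:
  fixes q b :: "real ^ 'n"
  assumes "z \<in> cube (\<chi> i. q $ i - r) (3 * r)" "z \<in> cube b s" "0 < r" "r \<le> \<rho>" "s \<le> \<rho>"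
  shows "cube q r \<subseteq> cube (\<chi> i. b $ i - 3 * \<rho>) (7 * \<rho>)"
proof
  fix x assume x: "x \<in> cube q r"
  show "x \<in> cube (\<chi> i. b $ i - 3 * \<rho>) (7 * \<rho>)"
    unfolding mem_cube vec_lambda_beta
  proof
    fix i
    have "q $ i - r \<le> z $ i" "z $ i \<le> q $ i - r + 3 * r" "b $ i \<le> z $ i" "z $ i \<le> b $ i + s"
      "q $ i \<le> x $ i" "x $ i \<le> q $ i + r"
      using assms(1,2) x by (simp_all add: mem_cube)
    then show "b $ i - 3 * \<rho> \<le> x $ i \<and> x $ i \<le> b $ i - 3 * \<rho> + 7 * \<rho>"
      using assms(3-5) by linarith
  qed
qed

lemma sum_half_powers_le: "finite A \<Longrightarrow> (\<Sum>k\<in>A. (1 / 2 :: real) ^ k) \<le> 2"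
  using sum_le_suminf[OF summable_geometric, of "1 / 2 :: real" A] suminf_geometric[of "1 / 2 :: real"] by simp

text \<open>The balayage of disjoint sets \<open>E j\<close>: the mass of each is spread evenly, up to the smooth cutoff,
  over a cube containing it.\<close>

locale balayage = doubling_cubes \<mu> D for \<mu> :: "(real ^ 'n) measure" and D +
  fixes J :: "'j set" and q :: "'j \<Rightarrow> real ^ 'n" and r :: "'j \<Rightarrow> real" and E :: "'j \<Rightarrow> (real ^ 'n) set"
  assumes fin_J: "finite J" and r_pos: "j \<in> J \<Longrightarrow> 0 < r j"
    and borel_E: "j \<in> J \<Longrightarrow> E j \<in> sets borel"
    and E_subset: "j \<in> J \<Longrightarrow> E j \<subseteq> cube (q j) (r j)"
    and disj_E: "disjoint_family_on E J"
begin

definition coef :: "'j \<Rightarrow> real" where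
  "coef j = measure \<mu> (E j) / measure \<mu> (cube (q j) (r j))"

definition swept :: "real ^ 'n \<Rightarrow> real" where
  "swept y = (\<Sum>j\<in>J. coef j * bump (q j) (r j) y)"

lemma coef_nonneg: "0 \<le> coef j"
  by (simp add: coef_def)

lemma borel_swept [measurable]: "swept \<in> borel_measurable borel"
  unfolding swept_def[abs_def] by measurable

lemma swept_nonneg: "0 \<le> swept y"
  unfolding swept_def by (intro sum_nonneg mult_nonneg_nonneg coef_nonneg bump_nonneg)

lemma swept_bounded: "\<bar>swept y\<bar> \<le> (\<Sum>j\<in>J. coef j)"
proof -
  have "swept y \<le> (\<Sum>j\<in>J. coef j * 1)"
    unfolding swept_def by (intro sum_mono mult_left_mono bump_le_1 coef_nonneg r_pos)
  then show ?thesis using swept_nonneg[of y] by simp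
qed

lemma fmeasurable_E: "j \<in> J \<Longrightarrow> E j \<in> fmeasurable \<mu>"
  using r_pos borel_E E_subset by (intro fmeasurable_subset_cube)

lemma sum_measure_E_le:
  assumes "I \<subseteq> J" "\<And>j. j \<in> I \<Longrightarrow> E j \<subseteq> A" "A \<in> fmeasurable \<mu>"
  shows "(\<Sum>j\<in>I. measure \<mu> (E j)) \<le> measure \<mu> A"
proof -
  have fin: "finite I" using assms(1) fin_J by (rule finite_subset)
  have E: "E j \<in> fmeasurable \<mu>" if "j \<in> I" for j using fmeasurable_E assms(1) that by blast
  have "(\<Sum>j\<in>I. measure \<mu> (E j)) = measure \<mu> (\<Union>j\<in>I. E j)"
    using fin E disjoint_family_on_mono[OF assms(1) disj_E]
    by (intro measure_finite_Union[symmetric]) (auto simp: fmeasurableD fmeasurableD2)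
  also have "\<dots> \<le> measure \<mu> A"
    using fin E assms by (intro measure_mono_fmeasurable sets.finite_UN) (auto simp: fmeasurable_def)
  finally show ?thesis .
qed

lemma integral_bump_le:
  assumes j: "j \<in> J" and A: "A \<in> sets borel"
  shows "coef j * (LINT y:A|\<mu>. bump (q j) (r j) y) \<le> D * measure \<mu> (E j)"
proof -
  let ?S = "cube (\<chi> i. q j $ i - r j) (3 * r j)" and ?R = "cube (q j) (r j)"
  note r = r_pos[OF j]
  have fmS: "?S \<in> fmeasurable \<mu>" using r by (intro fmeasurable_cube) simp
  have "(LINT y:A|\<mu>. bump (q j) (r j) y) \<le> (LINT y|\<mu>. indicator ?S y)"
    unfolding set_lebesgue_integral_def
  proof (rule integral_mono')
    show "integrable \<mu> (indicator ?S :: _ \<Rightarrow> real)"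
      using fmS by (intro integrable_real_indicator) (auto simp: fmeasurable_def)
    show "indicator A y *\<^sub>R bump (q j) (r j) y \<le> indicator ?S y" for y
      using bump_support[OF r, of "q j" y] bump_le_1[OF r, of "q j" y]
      by (cases "bump (q j) (r j) y = 0") (auto simp: indicator_def)
  qed (simp add: indicator_def)
  also have "\<dots> = measure \<mu> ?S" by simp
  also have "\<dots> \<le> D * measure \<mu> ?R"
    using r by (intro doubling cube_subset_cube) auto
  finally have "coef j * (LINT y:A|\<mu>. bump (q j) (r j) y) \<le> coef j * (D * measure \<mu> ?R)"
    by (rule mult_left_mono) (rule coef_nonneg)
  also have "\<dots> = D * measure \<mu> (E j)"
    using measure_cube_pos[OF r, of "q j"] by (simp add: coef_def)
  finally show ?thesis .
qed

lemma set_integrable_bump: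
  assumes "A \<in> fmeasurable \<mu>" "j \<in> J"
  shows "set_integrable \<mu> A (bump (q j) (r j))"
proof -
  have "norm (bump (q j) (r j) y) \<le> 1" for y
    using bump_nonneg[of "q j" "r j" y] bump_le_1[OF r_pos[OF assms(2)], of "q j" y] by simp
  then show ?thesis
    using assms(1) unfolding set_integrable_def
    by (intro integrableI_bounded_set_indicator[where B = 1]) (auto simp: fmeasurable_def)
qed

lemma set_integral_sum_bump:
  assumes "A \<in> fmeasurable \<mu>" "I \<subseteq> J"
  shows "set_integrable \<mu> A (\<lambda>y. \<Sum>j\<in>I. coef j * bump (q j) (r j) y)"
    and "(LINT y:A|\<mu>. (\<Sum>j\<in>I. coef j * bump (q j) (r j) y)) =
      (\<Sum>j\<in>I. coef j * (LINT y:A|\<mu>. bump (q j) (r j) y))"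
proof -
  have int: "integrable \<mu> (\<lambda>y. coef j * (indicator A y *\<^sub>R bump (q j) (r j) y))" if "j \<in> I" for j
    using set_integrable_bump[OF assms(1), of j] that assms(2) by (auto simp: set_integrable_def)
  have eq: "indicator A y *\<^sub>R (\<Sum>j\<in>I. coef j * bump (q j) (r j) y) =
      (\<Sum>j\<in>I. coef j * (indicator A y *\<^sub>R bump (q j) (r j) y))" for y
    by (simp add: sum_distrib_left mult_ac)
  show "set_integrable \<mu> A (\<lambda>y. \<Sum>j\<in>I. coef j * bump (q j) (r j) y)"
    unfolding set_integrable_def eq using int by (rule Bochner_Integration.integrable_sum)
  show "(LINT y:A|\<mu>. (\<Sum>j\<in>I. coef j * bump (q j) (r j) y)) =
      (\<Sum>j\<in>I. coef j * (LINT y:A|\<mu>. bump (q j) (r j) y))"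
    unfolding set_lebesgue_integral_def eq using int
    by (subst Bochner_Integration.integral_sum) auto
qed

text \<open>Cubes of side comparable to \<open>2 ^ k * s\<close> that come near \<open>cube b s\<close> have measure comparable to
  that of one large cube containing all of them; as the sets \<open>E j\<close> are disjoint, each generation
  \<open>k\<close> contributes at most \<open>D\<close> to the sum of the coefficients, and the factor \<open>s / r j\<close> makes the
  contributions of the generations decay geometrically.\<close>

lemma sum_weight_large_cubes_le:
  assumes s: "0 < s" and I: "I \<subseteq> J" and large: "\<And>j. j \<in> I \<Longrightarrow> s < r j"
    and meets: "\<And>j. j \<in> I \<Longrightarrow> cube (\<chi> i. q j $ i - r j) (3 * r j) \<inter> cube b s \<noteq> {}"
  shows "(\<Sum>j\<in>I. coef j * (s / r j)) \<le> 2 * D"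
proof -
  have finI: "finite I" using I fin_J by (rule finite_subset)
  define \<kappa> where "\<kappa> j = (LEAST k. r j \<le> 2 ^ Suc k * s)" for j
  have \<kappa>: "r j \<le> 2 ^ Suc (\<kappa> j) * s" "2 ^ \<kappa> j * s < r j" if j: "j \<in> I" for j
  proof -
    obtain k :: nat where "r j / s < 2 ^ k" using real_arch_pow[of 2 "r j / s"] by auto
    then have "r j < 2 ^ k * s" using s by (simp add: pos_divide_less_eq)
    moreover have "0 \<le> 2 ^ k * s" using s by simp
    ultimately have "r j \<le> 2 ^ Suc k * s" by simp
    then show "r j \<le> 2 ^ Suc (\<kappa> j) * s" unfolding \<kappa>_def by (rule LeastI)
    show "2 ^ \<kappa> j * s < r j"
    proof (cases "\<kappa> j")
      case 0
      then show ?thesis using large[OF j] by simp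
    next
      case (Suc k)
      then have "k < \<kappa> j" by simp
      then have "\<not> r j \<le> 2 ^ Suc k * s" unfolding \<kappa>_def by (rule not_less_Least)
      then show ?thesis using Suc by simp
    qed
  qed
  have generation: "(\<Sum>j | j \<in> I \<and> \<kappa> j = k. coef j) \<le> D" for k
  proof -
    define \<rho> where "\<rho> = 2 ^ Suc k * s"
    let ?I = "{j \<in> I. \<kappa> j = k}" and ?B = "cube (\<chi> i. b $ i - 3 * \<rho>) (7 * \<rho>)"
    have "(1 :: real) \<le> 2 ^ Suc k" by (rule one_le_power) simp
    then have "1 * s \<le> \<rho>" unfolding \<rho>_def using s by (intro mult_right_mono) auto
    with s have \<rho>: "0 < \<rho>" "s \<le> \<rho>" by auto
    have fmB: "?B \<in> fmeasurable \<mu>" and posB: "0 < measure \<mu> ?B"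
      using \<rho> by (auto intro: fmeasurable_cube measure_cube_pos)
    have sub: "cube (q j) (r j) \<subseteq> ?B" if j: "j \<in> ?I" for j
    proof -
      obtain z where "z \<in> cube (\<chi> i. q j $ i - r j) (3 * r j)" "z \<in> cube b s"
        using meets[of j] j by blast
      then show ?thesis
        using r_pos[of j] I j \<kappa>(1)[of j] \<rho>(2) by (intro cube_subset_inflated[of z "q j" "r j" b s]) (auto simp: \<rho>_def)
    qed
    have "coef j \<le> measure \<mu> (E j) * (D / measure \<mu> ?B)" if j: "j \<in> ?I" for j
    proof -
      have r: "0 < r j" using r_pos I j by blast
      have "\<rho> < 2 * r j" using \<kappa>(2)[of j] j by (simp add: \<rho>_def)
      then have "7 * \<rho> \<le> 16 * r j" using r by linarith
      then have "measure \<mu> ?B \<le> D * measure \<mu> (cube (q j) (r j))"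
        using r \<rho>(1) sub[OF j] by (intro doubling) auto
      then have "1 / measure \<mu> (cube (q j) (r j)) \<le> D / measure \<mu> ?B"
        using posB measure_cube_pos[OF r, of "q j"] by (simp add: field_simps)
      then have "measure \<mu> (E j) * (1 / measure \<mu> (cube (q j) (r j))) \<le> measure \<mu> (E j) * (D / measure \<mu> ?B)"
        by (rule mult_left_mono) simp
      then show ?thesis by (simp add: coef_def)
    qed
    then have "(\<Sum>j\<in>?I. coef j) \<le> (\<Sum>j\<in>?I. measure \<mu> (E j)) * (D / measure \<mu> ?B)"
      unfolding sum_distrib_right by (rule sum_mono)
    also have "\<dots> \<le> measure \<mu> ?B * (D / measure \<mu> ?B)"
      using I sub E_subset fmB D_ge_1 by (intro mult_right_mono sum_measure_E_le) (auto, blast)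
    also have "\<dots> = D" using posB by simp
    finally show ?thesis .
  qed
  have "(\<Sum>j\<in>I. coef j * (s / r j)) \<le> (\<Sum>j\<in>I. coef j * (1 / 2) ^ \<kappa> j)"
  proof (intro sum_mono mult_left_mono coef_nonneg)
    fix j assume j: "j \<in> I"
    have "0 < r j" using r_pos I j by blast
    then show "s / r j \<le> (1 / 2) ^ \<kappa> j"
      using \<kappa>(2)[OF j] by (simp add: field_simps power_divide)
  qed
  also have "\<dots> = (\<Sum>k\<in>\<kappa> ` I. \<Sum>j | j \<in> I \<and> \<kappa> j = k. coef j * (1 / 2) ^ \<kappa> j)"
    by (rule sum.image_gen[OF finI])
  also have "\<dots> = (\<Sum>k\<in>\<kappa> ` I. (\<Sum>j | j \<in> I \<and> \<kappa> j = k. coef j) * (1 / 2) ^ k)"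
    unfolding sum_distrib_right by (intro sum.cong refl) auto
  also have "\<dots> \<le> (\<Sum>k\<in>\<kappa> ` I. D * (1 / 2) ^ k)"
    using generation by (intro sum_mono mult_right_mono) auto
  also have "\<dots> = D * (\<Sum>k\<in>\<kappa> ` I. (1 / 2) ^ k)" by (simp only: sum_distrib_left)
  also have "\<dots> \<le> D * 2"
    using finI D_ge_1 by (intro mult_left_mono sum_half_powers_le) auto
  finally show ?thesis by simp
qed

text \<open>On a cube of side \<open>s\<close>, the cubes of side at most \<open>s\<close> contribute a function of bounded average,
  because their sets \<open>E j\<close> lie in a fixed dilate of the cube; the larger ones contribute a function that
  is almost constant there, by the Lipschitz bound on the bumps. The estimate involves neither the
  number of sets nor their sizes.\<close>

theorem balayage_oscillation:
  assumes s: "0 < s"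
  shows "(LINT x:cube b s|\<mu>. \<bar>swept x - average \<mu> swept (cube b s)\<bar>)
    \<le> 2 * (D ^ 2 + 2 * CARD('n) * D) * measure \<mu> (cube b s)"
proof -
  let ?X = "cube b s"
  let ?\<phi> = "\<lambda>j. bump (q j) (r j)"
  note fmX = fmeasurable_cube[OF s, of b]
  define I where "I = {j \<in> J. cube (\<chi> i. q j $ i - r j) (3 * r j) \<inter> ?X \<noteq> {}}"
  define I1 where "I1 = {j \<in> I. r j \<le> s}"
  define I2 where "I2 = {j \<in> I. s < r j}"
  have sub: "I1 \<subseteq> J" "I2 \<subseteq> J" by (auto simp: I_def I1_def I2_def)
  have fin: "finite I1" "finite I2" using sub fin_J by (auto intro: finite_subset)
  define F1 where "F1 y = (\<Sum>j\<in>I1. coef j * ?\<phi> j y)" for y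
  define F2 where "F2 y = (\<Sum>j\<in>I2. coef j * ?\<phi> j y)" for y
  define K where "K = 2 * CARD('n) * D"
  have split: "swept y = F1 y + F2 y" if y: "y \<in> ?X" for y
  proof -
    have "swept y = (\<Sum>j\<in>I1 \<union> I2. coef j * ?\<phi> j y)"
      unfolding swept_def
    proof (rule sum.mono_neutral_right)
      show "\<forall>j\<in>J - (I1 \<union> I2). coef j * ?\<phi> j y = 0"
      proof
        fix j assume j: "j \<in> J - (I1 \<union> I2)"
        then have "y \<notin> cube (\<chi> i. q j $ i - r j) (3 * r j)"
          using y by (auto simp: I_def I1_def I2_def)
        then show "coef j * ?\<phi> j y = 0" using bump_support[OF r_pos[of j], of "q j" y] j by auto
      qed
    qed (use sub fin_J in auto)
    also have "\<dots> = F1 y + F2 y"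
      unfolding F1_def F2_def using fin by (intro sum.union_disjoint) (auto simp: I1_def I2_def)
    finally show ?thesis .
  qed
  have large: "\<bar>F2 y - F2 b\<bar> \<le> K" if y: "y \<in> ?X" for y
  proof -
    have "dist y b \<le> CARD('n) * s" using y corner_mem_cube[of s b] s by (intro dist_cube_le) auto
    then have "\<bar>?\<phi> j y - ?\<phi> j b\<bar> \<le> CARD('n) * s / r j" if "j \<in> I2" for j
      using bump_lipschitz[OF r_pos[of j], of "q j" y b] sub that r_pos[of j]
      by (smt (verit) divide_right_mono subsetD)
    then have le: "\<bar>coef j * (?\<phi> j y - ?\<phi> j b)\<bar> \<le> coef j * (CARD('n) * s / r j)" if "j \<in> I2" for j
      unfolding abs_mult abs_of_nonneg[OF coef_nonneg] using that
      by (intro mult_left_mono coef_nonneg) auto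
    have "\<bar>F2 y - F2 b\<bar> \<le> (\<Sum>j\<in>I2. coef j * (CARD('n) * s / r j))"
      unfolding F2_def sum_subtractf[symmetric] right_diff_distrib[symmetric]
      using le by (intro order_trans[OF sum_abs] sum_mono)
    also have "\<dots> = CARD('n) * (\<Sum>j\<in>I2. coef j * (s / r j))"
      by (simp add: sum_distrib_left mult_ac)
    also have "\<dots> \<le> CARD('n) * (2 * D)"
      using s sub by (intro mult_left_mono sum_weight_large_cubes_le[where b = b]) (auto simp: I2_def I_def)
    finally show ?thesis by (simp add: K_def)
  qed
  have small: "(LINT y:?X|\<mu>. F1 y) \<le> D ^ 2 * measure \<mu> ?X"
  proof -
    let ?B = "cube (\<chi> i. b $ i - 3 * s) (7 * s)"
    have "(LINT y:?X|\<mu>. F1 y) = (\<Sum>j\<in>I1. coef j * (LINT y:?X|\<mu>. ?\<phi> j y))"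
      unfolding F1_def by (rule set_integral_sum_bump[OF fmX sub(1)])
    also have "\<dots> \<le> (\<Sum>j\<in>I1. D * measure \<mu> (E j))"
      using sub by (intro sum_mono integral_bump_le) auto
    also have "\<dots> = D * (\<Sum>j\<in>I1. measure \<mu> (E j))" by (simp only: sum_distrib_left)
    also have "\<dots> \<le> D * measure \<mu> ?B"
    proof (intro mult_left_mono sum_measure_E_le sub)
      fix j assume j: "j \<in> I1"
      then obtain z where "z \<in> cube (\<chi> i. q j $ i - r j) (3 * r j)" "z \<in> ?X" by (auto simp: I1_def I_def)
      then have "cube (q j) (r j) \<subseteq> ?B"
        using r_pos[of j] sub j by (intro cube_subset_inflated[of z "q j" "r j" b s]) (auto simp: I1_def)
      then show "E j \<subseteq> ?B" using E_subset[of j] sub j by blast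
    qed (use s D_ge_1 in \<open>auto intro: fmeasurable_cube\<close>)
    also have "\<dots> \<le> D * (D * measure \<mu> ?X)"
      using s D_ge_1 by (intro mult_left_mono doubling cube_subset_cube) auto
    finally show ?thesis by (simp add: power2_eq_square)
  qed
  have int: "set_integrable \<mu> ?X swept" "set_integrable \<mu> ?X F1"
    unfolding swept_def[abs_def] F1_def[abs_def] using set_integral_sum_bump(1)[OF fmX] sub by auto
  have intK: "set_integrable \<mu> ?X (\<lambda>_. K)"
    using fmX unfolding set_integrable_def by (simp add: fmeasurable_def)
  have "(LINT x:?X|\<mu>. \<bar>swept x - average \<mu> swept ?X\<bar>) \<le> 2 * (LINT x:?X|\<mu>. \<bar>swept x - F2 b\<bar>)"
    using fmX measure_cube_pos[OF s] int(1) by (rule mean_oscillation_le)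
  also have "(LINT x:?X|\<mu>. \<bar>swept x - F2 b\<bar>) \<le> (LINT x:?X|\<mu>. F1 x + K)"
  proof (rule set_integral_mono)
    show "set_integrable \<mu> ?X (\<lambda>x. \<bar>swept x - F2 b\<bar>)" using int(1) fmX by (rule set_integrable_diff_const)
    show "set_integrable \<mu> ?X (\<lambda>x. F1 x + K)" using int(2) intK by (rule set_integral_add)
    show "\<bar>swept x - F2 b\<bar> \<le> F1 x + K" if x: "x \<in> ?X" for x
    proof -
      have "0 \<le> F1 x" unfolding F1_def by (intro sum_nonneg mult_nonneg_nonneg coef_nonneg bump_nonneg)
      then show ?thesis using split[OF x] large[OF x] by linarith
    qed
  qed
  also have "\<dots> = (LINT x:?X|\<mu>. F1 x) + K * measure \<mu> ?X"
    by (simp add: set_integral_add(2)[OF int(2) intK] set_integral_constant[OF fmX])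
  also have "\<dots> \<le> (D ^ 2 + K) * measure \<mu> ?X" using small by (simp add: distrib_right)
  finally show ?thesis by (simp add: K_def algebra_simps)
qed

end

section \<open>From the weighted bound to the maximal function\<close>

lemma divide_ennreal_le_iff:
  assumes "0 < y"
  shows "X / ennreal y \<le> c \<longleftrightarrow> X \<le> c * ennreal y"
proof
  assume "X / ennreal y \<le> c"
  then have "X / ennreal y * ennreal y \<le> c * ennreal y" by (rule mult_right_mono) simp
  then show "X \<le> c * ennreal y" using assms by (simp add: ennreal_divide_times)
next
  assume "X \<le> c * ennreal y"
  then show "X / ennreal y \<le> c"
    using assms by (intro divide_le_posI_ennreal) (auto simp: mult.commute)
qed

context doubling_cubes
begin

lemma bounded_imp_locally_integrable:
  assumes [measurable]: "f \<in> borel_measurable borel" and bound: "\<And>x. \<bar>f x\<bar> \<le> K"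
  shows "locally_integrable \<mu> f"
  unfolding locally_integrable_def
proof (intro allI impI)
  fix A :: "(real ^ 'n) set" assume A: "compact A"
  then obtain B where B: "0 < B" "\<And>x. x \<in> A \<Longrightarrow> norm x \<le> B"
    using compact_imp_bounded bounded_pos by metis
  have "A \<subseteq> cube (\<chi> i. - B) (2 * B)"
  proof
    fix x assume "x \<in> A"
    then have "\<bar>x $ i\<bar> \<le> B" for i using B(2) component_le_norm_cart order_trans by blast
    then show "x \<in> cube (\<chi> i. - B) (2 * B)" by (simp add: mem_cube abs_le_iff minus_le_iff)
  qed
  moreover have "A \<in> sets borel" using A by (simp add: borel_compact)
  ultimately have "A \<in> fmeasurable \<mu>" using B(1) by (intro fmeasurable_subset_cube) auto
  then show "set_integrable \<mu> A f"
    unfolding set_integrable_def using bound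
    by (intro integrableI_bounded_set_indicator[where B = K]) (auto simp: fmeasurable_def)
qed

lemma nn_integral_weight:
  assumes w: "weight \<mu> w" and f: "locally_integrable \<mu> f" and l: "0 < l"
  shows "(\<integral>\<^sup>+x\<in>cube a l. ennreal \<bar>f x - c\<bar> \<partial>density \<mu> (\<lambda>x. ennreal (w x))) =
    (\<integral>\<^sup>+x\<in>cube a l. ennreal (w x) * ennreal \<bar>f x - c\<bar> \<partial>\<mu>)"
proof -
  have [measurable]: "w \<in> borel_measurable \<mu>" "f \<in> borel_measurable \<mu>"
    using w f locally_integrable_borel by (auto simp: weight_def)
  show ?thesis by (subst nn_integral_density) (auto simp: mult_ac)
qed

lemma weighted_bmo_boundD:
  assumes bound: "weighted_bmo_bound \<mu> Y w B" and w: "weight \<mu> w" and B: "0 < B"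
    and Y: "0 < Y (cube a l)" and l: "0 < l"
    and f: "locally_integrable \<mu> f" and \<beta>: "0 \<le> \<beta>" "bmo_norm \<mu> f \<le> ennreal \<beta>"
  shows "(\<integral>\<^sup>+x\<in>cube a l. ennreal (w x) * ennreal \<bar>f x - average \<mu> f (cube a l)\<bar> \<partial>\<mu>)
    \<le> ennreal (\<beta> * B * Y (cube a l))"
proof -
  have "bmo_norm \<mu> f < \<infinity>" using \<beta>(2) by (simp add: le_less_trans)
  then have "f \<in> BMO \<mu>" using f by (simp add: BMO_def)
  then have "(\<integral>\<^sup>+x\<in>cube a l. ennreal \<bar>f x - average \<mu> f (cube a l)\<bar> \<partial>density \<mu> (\<lambda>x. ennreal (w x)))
      / ennreal (Y (cube a l)) \<le> ennreal B * bmo_norm \<mu> f"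
    using bound cube_in_cubes[OF l] unfolding weighted_bmo_bound_def by blast
  also have "\<dots> \<le> ennreal B * ennreal \<beta>" using \<beta>(2) by (rule mult_left_mono) simp
  finally have "(\<integral>\<^sup>+x\<in>cube a l. ennreal \<bar>f x - average \<mu> f (cube a l)\<bar> \<partial>density \<mu> (\<lambda>x. ennreal (w x)))
      \<le> ennreal B * ennreal \<beta> * ennreal (Y (cube a l))"
    using Y by (simp add: divide_ennreal_le_iff)
  also have "\<dots> = ennreal (\<beta> * B * Y (cube a l))"
    using B \<beta>(1) Y by (simp add: ennreal_mult[symmetric] mult_ac)
  finally show ?thesis by (simp add: nn_integral_weight[OF w f l])
qed

text \<open>Testing with the indicator of a subcube \<open>A\<close> of half the side: both \<open>A\<close> and its complement in
  the cube carry at least the fraction \<open>1 / D\<close> of the mass, so that the indicator is at distance at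
  least \<open>1 / D\<close> from its mean everywhere on the cube.\<close>

lemma weight_cube_le:
  assumes bound: "weighted_bmo_bound \<mu> Y w B" and w: "weight \<mu> w" and B: "0 < B"
    and Y: "0 < Y (cube a l)" and l: "0 < l"
  shows "(\<integral>\<^sup>+x\<in>cube a l. ennreal (w x) \<partial>\<mu>) \<le> ennreal (D * B * Y (cube a l))"
proof -
  let ?X = "cube a l" and ?A = "cube a (l / 2)" and ?A' = "cube (\<chi> i. a $ i + 3 * l / 4) (l / 4)"
  let ?f = "indicator ?A :: real ^ 'n \<Rightarrow> real"
  have [measurable]: "w \<in> borel_measurable \<mu>"
    using w locally_integrable_borel by (auto simp: weight_def)
  have f: "locally_integrable \<mu> ?f"
    by (rule bounded_imp_locally_integrable[where K = 1]) (auto simp: indicator_def)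
  have avg: "average \<mu> ?f (cube b s) = measure \<mu> (?A \<inter> cube b s) / measure \<mu> (cube b s)" for b s
    by (simp add: average_def set_lebesgue_integral_def indicator_inter_arith[symmetric] Int_commute)
  have avg_le: "0 \<le> average \<mu> ?f (cube b s)" "average \<mu> ?f (cube b s) \<le> 1" if s: "0 < s" for b s
  proof -
    have "measure \<mu> (?A \<inter> cube b s) \<le> measure \<mu> (cube b s)"
      using fmeasurable_cube[OF s, of b] by (intro measure_mono_fmeasurable) auto
    then show "0 \<le> average \<mu> ?f (cube b s)" "average \<mu> ?f (cube b s) \<le> 1"
      using measure_cube_pos[OF s, of b] by (auto simp: avg)
  qed
  have "bmo_norm \<mu> ?f \<le> ennreal 1"
  proof (rule bmo_norm_le_iff[OF f, THEN iffD2], simp, intro allI impI)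
    fix b s assume s: "(0::real) < s"
    have fm: "cube b s \<in> fmeasurable \<mu>" using s by (rule fmeasurable_cube)
    have "set_integrable \<mu> (cube b s) ?f" using f by (intro set_integrable_subset_cube[of _ _ b s]) auto
    then have "set_integrable \<mu> (cube b s) (\<lambda>x. \<bar>?f x - average \<mu> ?f (cube b s)\<bar>)"
      using fm by (rule set_integrable_diff_const)
    moreover have "set_integrable \<mu> (cube b s) (\<lambda>x. 1 :: real)"
      using fm unfolding set_integrable_def by (simp add: fmeasurable_def)
    ultimately have "(LINT x:cube b s|\<mu>. \<bar>?f x - average \<mu> ?f (cube b s)\<bar>) \<le> (LINT x:cube b s|\<mu>. 1)"
      using avg_le[OF s, of b] by (intro set_integral_mono) (auto simp: indicator_def)
    then show "(LINT x:cube b s|\<mu>. \<bar>?f x - average \<mu> ?f (cube b s)\<bar>) \<le> 1 * measure \<mu> (cube b s)"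
      by (simp add: set_integral_constant[OF fm])
  qed
  then have *: "(\<integral>\<^sup>+x\<in>?X. ennreal (w x) * ennreal \<bar>?f x - average \<mu> ?f ?X\<bar> \<partial>\<mu>) \<le> ennreal (1 * B * Y ?X)"
    by (intro weighted_bmo_boundD bound w B Y l f) auto
  have far: "1 / D \<le> \<bar>?f x - average \<mu> ?f ?X\<bar>" for x
  proof -
    let ?\<theta> = "average \<mu> ?f ?X"
    have "?A \<subseteq> ?X" "?A' \<subseteq> ?X" by (rule cube_subset_cube; use l in simp)+
    note sub = this
    then have \<theta>: "?\<theta> = measure \<mu> ?A / measure \<mu> ?X" by (simp add: avg Int_absorb2)
    have fm: "?A \<in> fmeasurable \<mu>" "?A' \<in> fmeasurable \<mu>" "?X \<in> fmeasurable \<mu>"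
      using l by (auto intro!: fmeasurable_cube)
    have pos: "0 < measure \<mu> ?X" using l by (rule measure_cube_pos)
    have D: "measure \<mu> ?X \<le> D * measure \<mu> ?A" "measure \<mu> ?X \<le> D * measure \<mu> ?A'"
      using l sub by (auto intro!: doubling)
    have "?A \<inter> ?A' = {}"
    proof (rule ccontr)
      assume "?A \<inter> ?A' \<noteq> {}"
      then obtain z where "z \<in> ?A" "z \<in> ?A'" by blast
      then have "z $ i \<le> a $ i + l / 2" "a $ i + 3 * l / 4 \<le> z $ i" for i by (simp_all add: mem_cube)
      from this[of undefined] show False using l by linarith
    qed
    then have "measure \<mu> ?A + measure \<mu> ?A' = measure \<mu> (?A \<union> ?A')"
      using fm by (intro measure_Union[symmetric]) (auto simp: fmeasurable_def)
    also have "\<dots> \<le> measure \<mu> ?X"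
      using fm sub by (intro measure_mono_fmeasurable) auto
    finally have sum: "measure \<mu> ?A + measure \<mu> ?A' \<le> measure \<mu> ?X" .
    have "1 / D \<le> ?\<theta>" using D(1) D_ge_1 pos by (simp add: \<theta> field_simps)
    moreover have "1 / D \<le> measure \<mu> ?A' / measure \<mu> ?X" using D(2) D_ge_1 pos by (simp add: field_simps)
    moreover have "measure \<mu> ?A' / measure \<mu> ?X \<le> 1 - ?\<theta>" using sum pos by (simp add: \<theta> field_simps)
    ultimately show ?thesis by (auto simp: indicator_def)
  qed
  have "(\<integral>\<^sup>+x\<in>?X. ennreal (w x) \<partial>\<mu>) \<le>
      (\<integral>\<^sup>+x. ennreal D * (ennreal (w x) * ennreal \<bar>?f x - average \<mu> ?f ?X\<bar> * indicator ?X x) \<partial>\<mu>)"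
  proof (rule nn_integral_mono)
    fix x
    have "1 \<le> D * \<bar>?f x - average \<mu> ?f ?X\<bar>" using far[of x] D_ge_1 by (simp add: field_simps)
    then have "ennreal 1 \<le> ennreal D * ennreal \<bar>?f x - average \<mu> ?f ?X\<bar>"
      using D_ge_1 by (subst ennreal_mult[symmetric]) (auto intro!: ennreal_leI)
    then have "ennreal (w x) * indicator ?X x * ennreal 1 \<le>
        ennreal (w x) * indicator ?X x * (ennreal D * ennreal \<bar>?f x - average \<mu> ?f ?X\<bar>)"
      by (rule mult_left_mono) simp
    then show "ennreal (w x) * indicator ?X x \<le>
        ennreal D * (ennreal (w x) * ennreal \<bar>?f x - average \<mu> ?f ?X\<bar> * indicator ?X x)"
      by (simp add: mult_ac)
  qed
  also have "\<dots> = ennreal D * (\<integral>\<^sup>+x\<in>?X. ennreal (w x) * ennreal \<bar>?f x - average \<mu> ?f ?X\<bar> \<partial>\<mu>)"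
    by (rule nn_integral_cmult) measurable
  also have "\<dots> \<le> ennreal D * ennreal (1 * B * Y ?X)" using * by (rule mult_left_mono) simp
  also have "\<dots> = ennreal (D * B * Y ?X)" using D_ge_1 B Y by (subst ennreal_mult[symmetric]) (auto simp: mult_ac)
  finally show ?thesis .
qed

text \<open>Linearising the maximal function: a finite maximum of averages over cubes \<open>R j\<close> is dominated by
  averages over the \<open>R j\<close> on disjoint sets \<open>E j\<close>. Exchanging the order of integration turns its integral
  into the integral against \<open>w\<close> of a balayage. This is a BMO function with nonnegative mean at most
  \<open>D\<close>, so that the weighted bound and the bound for the mass of the cube apply.\<close>

lemma integral_finite_max_le:
  fixes q :: "nat \<Rightarrow> real ^ 'n" and r :: "nat \<Rightarrow> real"
  assumes bound: "weighted_bmo_bound \<mu> Y w B" and w: "weight \<mu> w" and B: "0 < B"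
    and Y: "0 < Y (cube a l)" and l: "0 < l" and r: "\<And>j. 0 < r j"
  shows "(\<integral>\<^sup>+x\<in>cube a l. (SUP j\<in>{..<N}.
      (\<integral>\<^sup>+y\<in>cube (q j) (r j). ennreal \<bar>w y * indicator (cube a l) y\<bar> \<partial>\<mu>) / emeasure \<mu> (cube (q j) (r j))
        * indicator (cube (q j) (r j)) x) \<partial>\<mu>)
    \<le> ennreal ((3 * D ^ 2 + 4 * CARD('n) * D) * B * Y (cube a l))"
proof -
  let ?X = "cube a l" and ?R = "\<lambda>j. cube (q j) (r j)"
  have [measurable]: "w \<in> borel_measurable \<mu>" and w0: "\<And>x. 0 \<le> w x"
    using w locally_integrable_borel by (auto simp: weight_def)
  define m where "m j = (\<integral>\<^sup>+y\<in>?R j. ennreal \<bar>w y * indicator ?X y\<bar> \<partial>\<mu>) / emeasure \<mu> (?R j)" for j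
  obtain E where disj: "disjoint_family_on E {..<N}"
    and E: "\<And>j. j < N \<Longrightarrow> E j \<in> sets \<mu>" "\<And>j. j < N \<Longrightarrow> E j \<subseteq> ?X \<inter> ?R j"
    and le: "\<And>x. x \<in> ?X \<Longrightarrow> (SUP j\<in>{..<N}. m j * indicator (?R j) x) \<le> (\<Sum>j<N. m j * indicator (E j) x)"
    using finite_max_le_disjoint_sum[where X = ?X and M = \<mu> and R = ?R and c = m and N = N] by auto
  interpret balayage \<mu> D "{..<N}" q r E
    using E r disj by unfold_locales (auto simp: sets_mu)
  note X = fmeasurable_cube[OF l, of a] measure_cube_pos[OF l, of a]
  define K where "K = 2 * (D ^ 2 + 2 * CARD('n) * D)"
  have K: "0 \<le> K" using D_ge_1 by (simp add: K_def)
  have loc_int: "locally_integrable \<mu> swept"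
    using borel_swept swept_bounded by (rule bounded_imp_locally_integrable)
  have "bmo_norm \<mu> swept \<le> ennreal K"
    using balayage_oscillation unfolding K_def[symmetric]
    by (intro bmo_norm_le_iff[OF loc_int K, THEN iffD2] allI impI)
  then have osc: "(\<integral>\<^sup>+x\<in>?X. ennreal (w x) * ennreal \<bar>swept x - average \<mu> swept ?X\<bar> \<partial>\<mu>) \<le> ennreal (K * B * Y ?X)"
    by (intro weighted_bmo_boundD bound w B Y l loc_int K)
  have avg: "0 \<le> average \<mu> swept ?X" "average \<mu> swept ?X \<le> D"
  proof -
    have "(LINT x:?X|\<mu>. swept x) = (\<Sum>j<N. coef j * (LINT y:?X|\<mu>. bump (q j) (r j) y))"
      unfolding swept_def by (rule set_integral_sum_bump[OF X(1)]) simp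
    also have "\<dots> \<le> (\<Sum>j<N. D * measure \<mu> (E j))"
      by (intro sum_mono integral_bump_le) auto
    also have "\<dots> = D * (\<Sum>j<N. measure \<mu> (E j))" by (simp only: sum_distrib_left)
    also have "\<dots> \<le> D * measure \<mu> ?X"
      using E D_ge_1 X by (intro mult_left_mono sum_measure_E_le) auto
    finally show "average \<mu> swept ?X \<le> D" using X by (simp add: average_def pos_divide_le_eq)
    show "0 \<le> average \<mu> swept ?X"
      unfolding average_def set_lebesgue_integral_def
      by (intro divide_nonneg_nonneg integral_nonneg_AE) (auto simp: swept_nonneg)
  qed
  have [measurable]: "swept \<in> borel_measurable \<mu>" using borel_swept by (simp add: measurable_cong_sets[OF sets_mu refl])
  have E' [measurable]: "E j \<in> sets \<mu>" if "j < N" for j using E(1) that .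
  have "(\<integral>\<^sup>+x\<in>?X. (SUP j\<in>{..<N}. m j * indicator (?R j) x) \<partial>\<mu>) \<le> (\<integral>\<^sup>+x. (\<Sum>j<N. m j * indicator (E j) x) \<partial>\<mu>)"
    using le by (intro nn_integral_mono) (auto simp: indicator_def)
  also have "\<dots> = (\<Sum>j<N. m j * emeasure \<mu> (E j))"
    using E(1) by (subst nn_integral_sum) (auto intro!: sum.cong nn_integral_cmult_indicator)
  also have "\<dots> = (\<Sum>j<N. ennreal (coef j) * (\<integral>\<^sup>+y\<in>?R j. ennreal \<bar>w y * indicator ?X y\<bar> \<partial>\<mu>))"
  proof (intro sum.cong refl)
    fix j assume "j \<in> {..<N}"
    then have Ej: "emeasure \<mu> (E j) = ennreal (measure \<mu> (E j))"
      using fmeasurable_E by (intro emeasure_eq_measure2)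
    let ?I = "\<integral>\<^sup>+y\<in>?R j. ennreal \<bar>w y * indicator ?X y\<bar> \<partial>\<mu>"
    have "m j * emeasure \<mu> (E j) = ennreal (measure \<mu> (E j)) * (?I / ennreal (measure \<mu> (?R j)))"
      by (simp only: m_def Ej emeasure_cube[OF r] mult.commute)
    also have "\<dots> = ennreal (measure \<mu> (E j)) / ennreal (measure \<mu> (?R j)) * ?I"
      by (simp only: ennreal_divide_times)
    also have "ennreal (measure \<mu> (E j)) / ennreal (measure \<mu> (?R j)) = ennreal (coef j)"
      using measure_cube_pos[OF r[of j], of "q j"] by (simp add: coef_def divide_ennreal)
    finally show "m j * emeasure \<mu> (E j) = ennreal (coef j) * ?I" .
  qed
  also have "\<dots> \<le> (\<Sum>j<N. \<integral>\<^sup>+y\<in>?X. ennreal (w y) * ennreal (coef j * bump (q j) (r j) y) \<partial>\<mu>)"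
  proof (rule sum_mono)
    fix j
    have "ennreal (coef j) * (\<integral>\<^sup>+y\<in>?R j. ennreal \<bar>w y * indicator ?X y\<bar> \<partial>\<mu>) =
        (\<integral>\<^sup>+y. ennreal (coef j) * (ennreal \<bar>w y * indicator ?X y\<bar> * indicator (?R j) y) \<partial>\<mu>)"
      by (rule nn_integral_cmult[symmetric]) measurable
    also have "\<dots> \<le> (\<integral>\<^sup>+y\<in>?X. ennreal (w y) * ennreal (coef j * bump (q j) (r j) y) \<partial>\<mu>)"
      by (intro nn_integral_mono)
        (auto simp: indicator_def bump_eq_1 w0 mult.commute split: if_splits)
    finally show "ennreal (coef j) * (\<integral>\<^sup>+y\<in>?R j. ennreal \<bar>w y * indicator ?X y\<bar> \<partial>\<mu>) \<le>
        (\<integral>\<^sup>+y\<in>?X. ennreal (w y) * ennreal (coef j * bump (q j) (r j) y) \<partial>\<mu>)" .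
  qed
  also have "\<dots> = (\<integral>\<^sup>+y\<in>?X. ennreal (w y) * ennreal (swept y) \<partial>\<mu>)"
  proof -
    have [measurable]: "bump (q j) (r j) \<in> borel_measurable \<mu>" for j
      using borel_bump by (simp add: measurable_cong_sets[OF sets_mu refl])
    have "ennreal (w y) * ennreal (swept y) * indicator ?X y =
        (\<Sum>j<N. ennreal (w y) * ennreal (coef j * bump (q j) (r j) y) * indicator ?X y)" for y
    proof -
      have "ennreal (swept y) = (\<Sum>j<N. ennreal (coef j * bump (q j) (r j) y))"
        unfolding swept_def by (rule sum_ennreal[symmetric]) (intro mult_nonneg_nonneg coef_nonneg bump_nonneg)
      then show ?thesis by (simp only: sum_distrib_left sum_distrib_right)
    qed
    then show ?thesis by (simp only:) (rule nn_integral_sum[symmetric], measurable)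
  qed
  also have "\<dots> \<le> (\<integral>\<^sup>+y. ennreal (w y) * ennreal \<bar>swept y - average \<mu> swept ?X\<bar> * indicator ?X y
      + ennreal D * (ennreal (w y) * indicator ?X y) \<partial>\<mu>)"
  proof (rule nn_integral_mono)
    fix y
    have "ennreal (swept y) \<le> ennreal (\<bar>swept y - average \<mu> swept ?X\<bar> + D)" using avg by (intro ennreal_leI) linarith
    also have "\<dots> = ennreal \<bar>swept y - average \<mu> swept ?X\<bar> + ennreal D" using D_ge_1 by (intro ennreal_plus) auto
    finally have "ennreal (w y) * indicator ?X y * ennreal (swept y) \<le>
        ennreal (w y) * indicator ?X y * (ennreal \<bar>swept y - average \<mu> swept ?X\<bar> + ennreal D)"
      by (rule mult_left_mono) simp
    then show "ennreal (w y) * ennreal (swept y) * indicator ?X y \<le>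
        ennreal (w y) * ennreal \<bar>swept y - average \<mu> swept ?X\<bar> * indicator ?X y + ennreal D * (ennreal (w y) * indicator ?X y)"
      by (simp add: distrib_left mult_ac)
  qed
  also have "\<dots> = (\<integral>\<^sup>+y\<in>?X. ennreal (w y) * ennreal \<bar>swept y - average \<mu> swept ?X\<bar> \<partial>\<mu>)
      + ennreal D * (\<integral>\<^sup>+y\<in>?X. ennreal (w y) \<partial>\<mu>)"
    by (subst nn_integral_add) (auto simp: nn_integral_cmult)
  also have "\<dots> \<le> ennreal (K * B * Y ?X) + ennreal D * ennreal (D * B * Y ?X)"
    using weight_cube_le[OF bound w B Y l] by (intro add_mono osc mult_left_mono) auto
  also have "\<dots> = ennreal ((3 * D ^ 2 + 4 * CARD('n) * D) * B * Y ?X)"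
    using D_ge_1 B Y K
    by (simp add: ennreal_mult[symmetric] ennreal_plus[symmetric] K_def power2_eq_square algebra_simps del: ennreal_plus)
  finally show ?thesis unfolding m_def .
qed

text \<open>The finite maxima increase to the maximal function, and the bound on them is uniform.\<close>

theorem A_infty_const_le:
  assumes bound: "weighted_bmo_bound \<mu> Y w B" and w: "weight \<mu> w" and B: "0 < B"
    and Y: "\<forall>Q\<in>cubes. 0 < Y Q"
  shows "A_infty_const \<mu> Y w \<le> ennreal ((3 * D ^ 2 + 4 * CARD('n) * D) * B)"
  unfolding A_infty_const_def
proof (rule SUP_least)
  let ?C = "3 * D ^ 2 + 4 * CARD('n) * D"
  fix X :: "(real ^ 'n) set" assume "X \<in> cubes"
  then obtain a l where l: "0 < l" and X: "X = cube a l" by (rule cubes_cases)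
  have YX: "0 < Y (cube a l)" using Y cube_in_cubes[OF l] by blast
  let ?g = "\<lambda>y. w y * indicator X y"
  obtain Q :: "nat \<Rightarrow> (real ^ 'n) set" where Q: "\<And>j. Q j \<in> cubes" and
    eq: "\<And>g x. maximal \<mu> g x =
       (SUP j. (\<integral>\<^sup>+y\<in>Q j. ennreal \<bar>g y\<bar> \<partial>\<mu>) / emeasure \<mu> (Q j) * indicator (Q j) x)"
    using maximal_countable_cubes by blast
  have "\<exists>b s. 0 < s \<and> Q j = cube b s" for j using Q[of j] by (auto simp: cubes_def)
  then obtain q r where r: "\<And>j. 0 < r j" and Qj: "\<And>j. Q j = cube (q j) (r j)" by metis
  define m where "m j = (\<integral>\<^sup>+y\<in>Q j. ennreal \<bar>?g y\<bar> \<partial>\<mu>) / emeasure \<mu> (Q j)" for j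
  have [measurable]: "Q j \<in> sets \<mu>" for j unfolding Qj by simp
  have [measurable]: "X \<in> sets \<mu>" unfolding X by simp
  let ?M = "\<lambda>N x. (SUP j\<in>{..<N}. m j * indicator (Q j) x) * indicator X x"
  have "(\<integral>\<^sup>+x\<in>X. maximal \<mu> ?g x \<partial>\<mu>) = (\<integral>\<^sup>+x. (SUP N. ?M N x) \<partial>\<mu>)"
  proof (rule nn_integral_cong)
    fix x
    have "(SUP j. m j * indicator (Q j) x) = (SUP N. SUP j\<in>{..<N}. m j * indicator (Q j) x)"
    proof (intro antisym SUP_least)
      fix j :: nat
      show "m j * indicator (Q j) x \<le> (SUP N. SUP j\<in>{..<N}. m j * indicator (Q j) x)"
        by (intro SUP_upper2[of "Suc j" UNIV] SUP_upper2[of j "{..<Suc j}"]) auto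
    qed (auto intro: SUP_upper)
    then show "maximal \<mu> ?g x * indicator X x = (SUP N. ?M N x)"
      by (simp add: eq[of ?g x, folded m_def] SUP_mult_right_ennreal)
  qed
  also have "\<dots> = (SUP N. \<integral>\<^sup>+x. ?M N x \<partial>\<mu>)"
  proof (rule nn_integral_monotone_convergence_SUP)
    show "incseq ?M"
      by (intro incseq_SucI le_funI mult_right_mono SUP_subset_mono) auto
    show "?M N \<in> borel_measurable \<mu>" for N by measurable
  qed
  also have "\<dots> \<le> ennreal (?C * B * Y X)"
    using integral_finite_max_le[OF bound w B YX l r] by (intro SUP_least) (simp add: m_def Qj X)
  also have "\<dots> = ennreal (?C * B) * ennreal (Y X)"
    using YX B D_ge_1 by (intro ennreal_mult) (auto simp: X)
  finally show "(\<integral>\<^sup>+x\<in>X. maximal \<mu> ?g x \<partial>\<mu>) / ennreal (Y X) \<le> ennreal (?C * B)"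
    using YX by (simp add: X divide_ennreal_le_iff)
qed

section \<open>From the maximal function to the weighted bound\<close>

theorem weighted_bmo_bound_of_A_infty:
  assumes w: "weight \<mu> w" and Y: "\<forall>Q\<in>cubes. 0 < Y Q"
    and A: "A_infty_const \<mu> Y w \<le> ennreal A" "0 \<le> A"
  shows "weighted_bmo_bound \<mu> Y w (12 * D ^ 3 * A)"
  unfolding weighted_bmo_bound_def ball_cubes
proof (intro ballI allI impI)
  fix f and a :: "real ^ 'n" and l :: real assume "f \<in> BMO \<mu>" and l: "0 < l"
  then have f: "locally_integrable \<mu> f" and fin: "bmo_norm \<mu> f < \<infinity>" by (auto simp: BMO_def)
  let ?X = "cube a l"
  have YX: "0 < Y ?X" using Y cube_in_cubes[OF l] by blast
  have wm [measurable]: "w \<in> borel_measurable \<mu>" and w0: "\<And>x. 0 \<le> w x"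
    using w locally_integrable_borel by (auto simp: weight_def)
  let ?g = "\<lambda>y. w y * indicator ?X y"
  define b where "b = enn2real (bmo_norm \<mu> f)"
  have b: "bmo_norm \<mu> f = ennreal b" "0 \<le> b" using fin by (auto simp: b_def)
  have "(\<integral>\<^sup>+x\<in>?X. maximal \<mu> ?g x \<partial>\<mu>) / ennreal (Y ?X) \<le> A_infty_const \<mu> Y w"
    unfolding A_infty_const_def using cube_in_cubes[OF l] by (intro SUP_upper)
  with A(1) have max: "(\<integral>\<^sup>+x\<in>?X. maximal \<mu> ?g x \<partial>\<mu>) \<le> ennreal A * ennreal (Y ?X)"
    using YX by (simp add: divide_ennreal_le_iff[symmetric])
  let ?I = "\<integral>\<^sup>+x\<in>?X. ennreal (w x) * ennreal \<bar>f x - average \<mu> f ?X\<bar> \<partial>\<mu>"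
  \<comment> \<open>the estimate needs a positive bound on the norm, which itself may vanish\<close>
  have main: "?I \<le> ennreal (12 * D ^ 3 * \<beta> * (A * Y ?X))" if \<beta>: "b < \<beta>" for \<beta>
  proof -
    have "bmo_norm \<mu> f \<le> ennreal \<beta>" using b \<beta> by (simp add: ennreal_leI)
    moreover have \<beta>0: "0 < \<beta>" using b \<beta> by simp
    ultimately have osc: "\<And>b s. 0 < s \<Longrightarrow>
        (LINT x:cube b s|\<mu>. \<bar>f x - average \<mu> f (cube b s)\<bar>) \<le> \<beta> * measure \<mu> (cube b s)"
      using bmo_norm_le_iff[OF f, of \<beta>] by simp
    have "?I \<le> ennreal (12 * D ^ 3 * \<beta>) * (\<integral>\<^sup>+x\<in>?X. maximal \<mu> ?g x \<partial>\<mu>)"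
    proof (rule weighted_oscillation_bound[OF l f \<beta>0 osc])
      show "(\<integral>\<^sup>+y\<in>cube c s. ennreal (w y) \<partial>\<mu>) \<le> maximal \<mu> ?g x * emeasure \<mu> (cube c s)"
        if cs: "0 < s" "cube c s \<subseteq> ?X" "x \<in> cube c s" for c s x
      proof -
        have "(\<integral>\<^sup>+y\<in>cube c s. ennreal (w y) \<partial>\<mu>) = (\<integral>\<^sup>+y\<in>cube c s. ennreal \<bar>?g y\<bar> \<partial>\<mu>)"
          using cs(2) by (intro nn_integral_cong) (auto simp: indicator_def w0)
        then show ?thesis using integral_cube_le_maximal[OF cs(1,3), of ?g] by simp
      qed
    qed auto
    also have "\<dots> \<le> ennreal (12 * D ^ 3 * \<beta>) * (ennreal A * ennreal (Y ?X))"
      using max by (rule mult_left_mono) simp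
    also have "\<dots> = ennreal (12 * D ^ 3 * \<beta> * (A * Y ?X))"
      using D_ge_1 \<beta>0 A(2) YX by (simp add: ennreal_mult[symmetric])
    finally show ?thesis .
  qed
  have "?I \<le> ennreal (12 * D ^ 3 * b * (A * Y ?X))"
  proof (rule tendsto_lowerbound)
    show "((\<lambda>\<beta>. ennreal (12 * D ^ 3 * \<beta> * (A * Y ?X))) \<longlongrightarrow> ennreal (12 * D ^ 3 * b * (A * Y ?X))) (at_right b)"
      by (intro tendsto_intros)
    show "\<forall>\<^sub>F \<beta> in at_right b. ?I \<le> ennreal (12 * D ^ 3 * \<beta> * (A * Y ?X))"
      using eventually_at_right_less[of b] by eventually_elim (rule main)
  qed simp
  also have "\<dots> = ennreal (12 * D ^ 3 * A) * bmo_norm \<mu> f * ennreal (Y ?X)"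
    using D_ge_1 A(2) YX b by (simp add: ennreal_mult[symmetric] mult_ac)
  finally have "?I \<le> ennreal (12 * D ^ 3 * A) * bmo_norm \<mu> f * ennreal (Y ?X)" .
  then show "(\<integral>\<^sup>+x\<in>?X. ennreal \<bar>f x - average \<mu> f ?X\<bar> \<partial>density \<mu> (\<lambda>x. ennreal (w x))) / ennreal (Y ?X)
      \<le> ennreal (12 * D ^ 3 * A) * bmo_norm \<mu> f"
    using YX by (simp add: nn_integral_weight[OF w f l] divide_ennreal_le_iff)
qed

end

section \<open>Equivalence of the two conditions\<close>

theorem theorem2p1:
  fixes \<mu> :: "(real ^ 'n) measure"
  assumes "doubling_measure \<mu>"
  shows "(\<forall>(Y :: (real ^ 'n) set \<Rightarrow> real) (w :: real ^ 'n \<Rightarrow> real).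
            (\<forall>Q\<in>cubes. 0 < Y Q) \<longrightarrow> weight \<mu> w \<longrightarrow>
              ((\<exists>B>0. weighted_bmo_bound \<mu> Y w B) \<longleftrightarrow> A_infty_const \<mu> Y w < \<infinity>))
       \<and> (\<exists>C1>0. \<exists>C2>0. \<forall>(Y :: (real ^ 'n) set \<Rightarrow> real) (w :: real ^ 'n \<Rightarrow> real).
            (\<forall>Q\<in>cubes. 0 < Y Q) \<longrightarrow> weight \<mu> w \<longrightarrow>
              ennreal C1 * best_bmo_const \<mu> Y w \<le> A_infty_const \<mu> Y w \<and>
              A_infty_const \<mu> Y w \<le> ennreal C2 * best_bmo_const \<mu> Y w)"
proof -
  obtain D where D: "doubling_cubes \<mu> D" using assms by (rule doubling_measure_imp_doubling_cubes)
  interpret doubling_cubes \<mu> D by (rule D)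
  define C2 where "C2 = 3 * D ^ 2 + 4 * CARD('n) * D"
  define K where "K = 12 * D ^ 3"
  have C2: "0 < C2" using D_ge_1 by (simp add: C2_def add_pos_nonneg)
  have K: "0 < K" using D_ge_1 by (simp add: K_def)
  have upper: "A_infty_const \<mu> Y w \<le> ennreal (C2 * B)"
    if "\<forall>Q\<in>cubes. 0 < Y Q" "weight \<mu> w" "0 < B" "weighted_bmo_bound \<mu> Y w B" for Y w B
    unfolding C2_def using A_infty_const_le[OF that(4,2,3,1)] .
  have lower: "weighted_bmo_bound \<mu> Y w (K * A)"
    if "\<forall>Q\<in>cubes. 0 < Y Q" "weight \<mu> w" "0 \<le> A" "A_infty_const \<mu> Y w \<le> ennreal A" for Y w A
    unfolding K_def using weighted_bmo_bound_of_A_infty[OF that(2,1,4,3)] .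
  have "(\<exists>B>0. weighted_bmo_bound \<mu> Y w B) \<longleftrightarrow> A_infty_const \<mu> Y w < \<infinity>"
    if Y: "\<forall>Q\<in>cubes. 0 < Y Q" and w: "weight \<mu> w" for Y w
  proof
    assume "\<exists>B>0. weighted_bmo_bound \<mu> Y w B"
    then obtain B where "0 < B" "weighted_bmo_bound \<mu> Y w B" by blast
    from upper[OF Y w this] show "A_infty_const \<mu> Y w < \<infinity>" by (simp add: le_less_trans)
  next
    assume "A_infty_const \<mu> Y w < \<infinity>"
    then have "A_infty_const \<mu> Y w \<le> ennreal (enn2real (A_infty_const \<mu> Y w) + 1)"
      by (subst ennreal_enn2real[symmetric]) (auto intro!: ennreal_leI)
    then have "weighted_bmo_bound \<mu> Y w (K * (enn2real (A_infty_const \<mu> Y w) + 1))"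
      by (intro lower Y w) auto
    moreover have "0 < K * (enn2real (A_infty_const \<mu> Y w) + 1)"
      using K by (intro mult_pos_pos add_nonneg_pos) auto
    ultimately show "\<exists>B>0. weighted_bmo_bound \<mu> Y w B" by blast
  qed
  moreover have "ennreal (1 / K) * best_bmo_const \<mu> Y w \<le> A_infty_const \<mu> Y w \<and>
      A_infty_const \<mu> Y w \<le> ennreal C2 * best_bmo_const \<mu> Y w"
    if Y: "\<forall>Q\<in>cubes. 0 < Y Q" and w: "weight \<mu> w" for Y w
  proof
    show "ennreal (1 / K) * best_bmo_const \<mu> Y w \<le> A_infty_const \<mu> Y w"
    \<comment> \<open>the constant \<open>K * A\<close> may be zero, but only positive constants compete for the best one\<close>
    proof (rule ennreal_le_epsilon)
      fix e :: real assume e: "0 < e" and "A_infty_const \<mu> Y w < top"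
      then obtain A where A: "A_infty_const \<mu> Y w = ennreal A" "0 \<le> A" by (cases "A_infty_const \<mu> Y w") auto
      have "weighted_bmo_bound \<mu> Y w (K * (A + e))"
        using A e by (intro lower Y w) (auto intro: ennreal_leI)
      then have "best_bmo_const \<mu> Y w \<le> ennreal (K * (A + e))"
        unfolding best_bmo_const_def using K A(2) e by (intro INF_lower) auto
      then have "ennreal (1 / K) * best_bmo_const \<mu> Y w \<le> ennreal (1 / K) * ennreal (K * (A + e))"
        by (rule mult_left_mono) simp
      also have "\<dots> = ennreal A + ennreal e"
        using K A(2) e by (simp add: ennreal_mult[symmetric])
      finally show "ennreal (1 / K) * best_bmo_const \<mu> Y w \<le> A_infty_const \<mu> Y w + ennreal e"
        by (simp add: A(1))
    qed
    have "A_infty_const \<mu> Y w / ennreal C2 \<le> best_bmo_const \<mu> Y w"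
      unfolding best_bmo_const_def
    proof (rule INF_greatest)
      fix B assume "B \<in> {B. 0 < B \<and> weighted_bmo_bound \<mu> Y w B}"
      then have "A_infty_const \<mu> Y w \<le> ennreal (C2 * B)" "0 < B" using upper[OF Y w] by auto
      then show "A_infty_const \<mu> Y w / ennreal C2 \<le> ennreal B"
        using C2 by (simp add: divide_ennreal_le_iff ennreal_mult[symmetric] mult.commute)
    qed
    then show "A_infty_const \<mu> Y w \<le> ennreal C2 * best_bmo_const \<mu> Y w"
      using C2 by (simp add: divide_ennreal_le_iff mult.commute)
  qed
  moreover have "0 < 1 / K" using K by simp
  ultimately show ?thesis using C2 by blast
qed

end
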